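(* Let $(M,\tau)$ be a tracial von Neumann algebra and let $X_1,\dots,X_n\in M$ be self-adjoint elements with $M=W^*(X_1,\dots,X_n)$. Let $T=(T_1,\dots,T_n)$ be an $n$-tuple of Hilbert--Schmidt operators on $L^2(M)$, and let $\partial_T$ be the derivation determined by $\partial_T(X_j)=T_j$ for $j=1,\dots,n$. The following are equivalent: (a) $\partial_T^*(P_1)$ exists; (b) there exists a closable (not necessarily bounded) operator $Y:L^2(M)\to L^2(M)$ whose domain includes $\mathbb{C}(X_1,\dots,X_n)$, such that $Y1=0$, $1$ belongs to the domain of $Y^*$, and $[Y,X_j]=T_j$ for all $j=1,\dots,n$.
   Context: A tracial von Neumann algebra $(M,\tau)$ is a von Neumann algebra with a faithful normal tracial state. $L^2(M)$ is the GNS Hilbert space of $\tau$, on which $M$ acts by left multiplication, with trace vector $1$. $W^*(X_1,\dots,X_n)$ is the von Neumann algebra generated by the $X_j$. $\mathbb{C}(X_1,\dots,X_n)\subset M$ is the unital algebra of all non-commutative polynomials in $X_1,\dots,X_n$; via $Q\mapsto Q\cdot 1$ it is also viewed as a (dense) subspace of $L^2(M)$. $HS$ is the Hilbert space of Hilbert--Schmidt operators on $L^2(M)$ with $\langle S,T\rangle_{HS}=Tr(T^*S)$, regarded as a bimodule over $\mathbb{C}(X_1,\dots,X_n)$ by composition of operators. $P_1\in HS$ is the orthogonal projection of $L^2(M)$ onto $\mathbb{C}1$. The derivation $\partial_T$ is determined by the Leibniz rule $\partial_T(QR)=\partial_T(Q)R+Q\,\partial_T(R)$, $\partial_T(1)=0$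 and $\partial_T(X_j)=T_j$; explicitly, on a formal non-commutative monomial it is $\partial_T(X_{i_1}\cdots X_{i_k})=\sum_{l=1}^k X_{i_1}\cdots X_{i_{l-1}}T_{i_l}X_{i_{l+1}}\cdots X_{i_k}$, extended linearly. "$\partial_T^*(P_1)$ exists" means that there is a vector $\xi\in L^2(M)$ (then denoted $\partial_T^*(P_1)$) such that $\langle \xi, p(X_1,\dots,X_n)1\rangle=\langle P_1,\partial_T(p)\rangle_{HS}$ for every non-commutative polynomial $p$ in $n$ variables. The equation $[Y,X_j]=T_j$ means $YX_j\zeta-X_jY\zeta=T_j\zeta$ for all $\zeta\in\mathbb{C}(X_1,\dots,X_n)\cdot 1$. *)

theory Defs
  imports "HOL-Analysis.Analysis" "HOL-Library.Poly_Mapping"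
begin

section \<open>Complex Hilbert spaces\<close>

class scaleC =
  fixes scaleC :: "complex \<Rightarrow> 'a \<Rightarrow> 'a"  (infixr "*\<^sub>C" 75)

text \<open>The inner product is linear in the first and conjugate linear in the second argument.
  Positive definiteness is contained in the last axiom together with the norm axioms.\<close>

class chilbert_space = banach + scaleC +
  fixes cinner :: "'a \<Rightarrow> 'a \<Rightarrow> complex"
  assumes scaleC_add_right: "c *\<^sub>C (x + y) = c *\<^sub>C x + c *\<^sub>C y"
    and scaleC_add_left: "(c + d) *\<^sub>C x = c *\<^sub>C x + d *\<^sub>C x"
    and scaleC_scaleC: "c *\<^sub>C (d *\<^sub>C x) = (c * d) *\<^sub>C x"
    and scaleC_of_real: "complex_of_real r *\<^sub>C x = r *\<^sub>R x"
    and cinner_commute: "cinner x y = cnj (cinner y x)"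
    and cinner_add_left: "cinner (x + y) z = cinner x z + cinner y z"
    and cinner_scaleC_left: "cinner (c *\<^sub>C x) y = c * cinner x y"
    and norm_eq_sqrt_cinner: "norm x = sqrt (Re (cinner x x))"

instantiation complex :: chilbert_space
begin

definition scaleC_complex :: "complex \<Rightarrow> complex \<Rightarrow> complex" where
  "scaleC_complex c x = c * x"

definition cinner_complex :: "complex \<Rightarrow> complex \<Rightarrow> complex" where
  "cinner_complex x y = x * cnj y"

instance
  by standard
    (auto simp: scaleC_complex_def cinner_complex_def algebra_simps scaleR_conv_of_real
      cmod_def power2_eq_square)

end

global_interpretation complex_vector:
  vector_space "scaleC :: complex \<Rightarrow> 'a::chilbert_space \<Rightarrow> 'a"
proof
  show "1 *\<^sub>C x = x" for x :: 'a
    using scaleC_of_real[of 1 x] by simp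
qed (simp_all add: scaleC_add_right scaleC_add_left scaleC_scaleC)

definition orthonormal_basis :: "'a::chilbert_space set \<Rightarrow> bool" where
  "orthonormal_basis B \<longleftrightarrow>
     (\<forall>e\<in>B. \<forall>f\<in>B. cinner e f = (if e = f then 1 else 0)) \<and>
     closure (complex_vector.span B) = UNIV"

definition orth_proj :: "'a::chilbert_space set \<Rightarrow> 'a \<Rightarrow> 'a" where
  "orth_proj S x = (THE y. y \<in> S \<and> (\<forall>z\<in>S. cinner (x - y) z = 0))"


section \<open>Bounded and Hilbert--Schmidt operators\<close>

definition bounded_clinear :: "('a::chilbert_space \<Rightarrow> 'a) \<Rightarrow> bool" where
  "bounded_clinear a \<longleftrightarrow> bounded_linear a \<and> (\<forall>c x. a (c *\<^sub>C x) = c *\<^sub>C a x)"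

definition cadj :: "('a::chilbert_space \<Rightarrow> 'a) \<Rightarrow> ('a \<Rightarrow> 'a)" where
  "cadj a = (THE b. \<forall>x y. cinner (a x) y = cinner x (b y))"

definition hilbert_schmidt :: "('a::chilbert_space \<Rightarrow> 'a) \<Rightarrow> bool" where
  "hilbert_schmidt a \<longleftrightarrow> bounded_clinear a \<and>
     (\<exists>B. orthonormal_basis B \<and> (\<lambda>e. (norm (a e))\<^sup>2) summable_on B)"

text \<open>On trace class operators the value does not depend on the chosen orthonormal basis.\<close>

definition op_trace :: "('a::chilbert_space \<Rightarrow> 'a) \<Rightarrow> complex" where
  "op_trace a = (\<Sum>\<^sub>\<infinity>e\<in>(SOME B. orthonormal_basis B). cinner (a e) e)"

definition hs_inner :: "('a::chilbert_space \<Rightarrow> 'a) \<Rightarrow> ('a \<Rightarrow> 'a) \<Rightarrow> complex" where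
  "hs_inner S T = op_trace (cadj T \<circ> S)"


section \<open>Tracial von Neumann algebras and the GNS representation\<close>

definition commutant :: "('a::chilbert_space \<Rightarrow> 'a) set \<Rightarrow> ('a \<Rightarrow> 'a) set" where
  "commutant S = {b. bounded_clinear b \<and> (\<forall>a\<in>S. a \<circ> b = b \<circ> a)}"

definition von_neumann_algebra :: "('a::chilbert_space \<Rightarrow> 'a) set \<Rightarrow> bool" where
  "von_neumann_algebra M \<longleftrightarrow>
     (\<forall>a\<in>M. bounded_clinear a) \<and> (\<forall>a\<in>M. cadj a \<in> M) \<and> commutant (commutant M) = M"

definition vn_generated :: "('a::chilbert_space \<Rightarrow> 'a) set \<Rightarrow> ('a \<Rightarrow> 'a) set" where
  "vn_generated S = \<Inter> {N. von_neumann_algebra N \<and> S \<subseteq> N}"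

text \<open>The ultraweak (\<open>\<sigma>\<close>-weak) topology on the bounded operators.\<close>

definition ultraweak_topology :: "('a::chilbert_space \<Rightarrow> 'a) topology" where
  "ultraweak_topology = topology_generated_by
     {{a. bounded_clinear a \<and> suminf (\<lambda>i. cinner (a (x i)) (y i)) \<in> U} | x y U.
        summable (\<lambda>i::nat. (norm (x i))\<^sup>2) \<and> summable (\<lambda>i. (norm (y i))\<^sup>2) \<and> open U}"

locale tracial_von_neumann_algebra =
  fixes M :: "('k::chilbert_space \<Rightarrow> 'k) set"
    and \<tau> :: "('k \<Rightarrow> 'k) \<Rightarrow> complex"
  assumes von_neumann: "von_neumann_algebra M"
    and trace_add: "\<lbrakk>a \<in> M; b \<in> M\<rbrakk> \<Longrightarrow> \<tau> (\<lambda>x. a x + b x) = \<tau> a + \<tau> b"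
    and trace_scale: "a \<in> M \<Longrightarrow> \<tau> (\<lambda>x. c *\<^sub>C a x) = c * \<tau> a"
    and trace_unit: "\<tau> id = 1"
    and trace_positive: "a \<in> M \<Longrightarrow> \<tau> (cadj a \<circ> a) \<in> \<real>\<^sub>\<ge>\<^sub>0"
    and trace_commute: "\<lbrakk>a \<in> M; b \<in> M\<rbrakk> \<Longrightarrow> \<tau> (a \<circ> b) = \<tau> (b \<circ> a)"
    and trace_faithful: "\<lbrakk>a \<in> M; \<tau> (cadj a \<circ> a) = 0\<rbrakk> \<Longrightarrow> a = (\<lambda>x. 0)"
    and trace_normal: "continuous_map (subtopology ultraweak_topology M) euclidean \<tau>"

text \<open>\<open>L\<^sup>2(M)\<close> is any Hilbert space \<open>'h\<close> carrying a GNS triple of \<open>\<tau>\<close>: \<open>\<pi> a\<close> is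
  left multiplication by \<open>a\<close>, \<open>\<Omega>\<close> is the trace vector \<open>1\<close>, and \<open>\<pi> a \<Omega>\<close> is the element \<open>a\<close>
  of \<open>M\<close> viewed as a vector.\<close>

locale gns_triple =
  fixes M :: "('k::chilbert_space \<Rightarrow> 'k) set"
    and \<tau> :: "('k \<Rightarrow> 'k) \<Rightarrow> complex"
    and \<pi> :: "('k \<Rightarrow> 'k) \<Rightarrow> ('h::chilbert_space \<Rightarrow> 'h)"
    and \<Omega> :: 'h
  assumes rep_bounded: "a \<in> M \<Longrightarrow> bounded_clinear (\<pi> a)"
    and rep_add: "\<lbrakk>a \<in> M; b \<in> M\<rbrakk> \<Longrightarrow> \<pi> (\<lambda>x. a x + b x) = (\<lambda>\<zeta>. \<pi> a \<zeta> + \<pi> b \<zeta>)"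
    and rep_scale: "a \<in> M \<Longrightarrow> \<pi> (\<lambda>x. c *\<^sub>C a x) = (\<lambda>\<zeta>. c *\<^sub>C \<pi> a \<zeta>)"
    and rep_mult: "\<lbrakk>a \<in> M; b \<in> M\<rbrakk> \<Longrightarrow> \<pi> (a \<circ> b) = \<pi> a \<circ> \<pi> b"
    and rep_unit: "\<pi> id = id"
    and rep_adj: "a \<in> M \<Longrightarrow> \<pi> (cadj a) = cadj (\<pi> a)"
    and cyclic: "closure ((\<lambda>a. \<pi> a \<Omega>) ` M) = UNIV"
    and vector_state: "a \<in> M \<Longrightarrow> cinner (\<pi> a \<Omega>) \<Omega> = \<tau> a"


section \<open>Non-commutative polynomials and the derivation\<close>

text \<open>Formal non-commutative polynomials in variables indexed by \<open>'n\<close> are finitely supported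
  families of coefficients indexed by words.\<close>

type_synonym 'n ncpoly = "'n list \<Rightarrow>\<^sub>0 complex"

text \<open>\<open>foldr A [i\<^sub>1, \<dots>, i\<^sub>k]\<close> is the composition of \<open>A i\<^sub>1, \<dots>, A i\<^sub>k\<close>.\<close>

definition nc_monom :: "('n \<Rightarrow> 'h \<Rightarrow> 'h) \<Rightarrow> 'n list \<Rightarrow> 'h \<Rightarrow> 'h" where
  "nc_monom A w = foldr A w"

definition nc_eval :: "('n \<Rightarrow> 'h \<Rightarrow> 'h) \<Rightarrow> 'n ncpoly \<Rightarrow> 'h::chilbert_space \<Rightarrow> 'h" where
  "nc_eval A p \<zeta> = (\<Sum>w\<in>Poly_Mapping.keys p. Poly_Mapping.lookup p w *\<^sub>C nc_monom A w \<zeta>)"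

definition nc_deriv_monom ::
    "('n \<Rightarrow> 'h \<Rightarrow> 'h) \<Rightarrow> ('n \<Rightarrow> 'h \<Rightarrow> 'h) \<Rightarrow> 'n list \<Rightarrow> 'h::chilbert_space \<Rightarrow> 'h" where
  "nc_deriv_monom A T w \<zeta> =
     (\<Sum>l<length w. nc_monom A (take l w) (T (w ! l) (nc_monom A (drop (Suc l) w) \<zeta>)))"

definition nc_deriv ::
    "('n \<Rightarrow> 'h \<Rightarrow> 'h) \<Rightarrow> ('n \<Rightarrow> 'h \<Rightarrow> 'h) \<Rightarrow> 'n ncpoly \<Rightarrow> 'h::chilbert_space \<Rightarrow> 'h" where
  "nc_deriv A T p \<zeta> =
     (\<Sum>w\<in>Poly_Mapping.keys p. Poly_Mapping.lookup p w *\<^sub>C nc_deriv_monom A T w \<zeta>)"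

definition nc_vectors :: "('n \<Rightarrow> 'h \<Rightarrow> 'h) \<Rightarrow> 'h::chilbert_space \<Rightarrow> 'h set" where
  "nc_vectors A \<Omega> = range (\<lambda>p. nc_eval A p \<Omega>)"


section \<open>Unbounded operators\<close>

text \<open>An unbounded operator is a pair of a domain \<open>D\<close> and a function \<open>Y\<close>; the values of \<open>Y\<close>
  outside \<open>D\<close> are irrelevant.\<close>

definition unbounded_operator :: "'h::chilbert_space set \<Rightarrow> ('h \<Rightarrow> 'h) \<Rightarrow> bool" where
  "unbounded_operator D Y \<longleftrightarrow> complex_vector.subspace D \<and>
     (\<forall>x\<in>D. \<forall>y\<in>D. Y (x + y) = Y x + Y y) \<and> (\<forall>c. \<forall>x\<in>D. Y (c *\<^sub>C x) = c *\<^sub>C Y x)"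

definition closable_operator :: "'h::chilbert_space set \<Rightarrow> ('h \<Rightarrow> 'h) \<Rightarrow> bool" where
  "closable_operator D Y \<longleftrightarrow> single_valued (closure ((\<lambda>x. (x, Y x)) ` D))"

definition adjoint_domain :: "'h::chilbert_space set \<Rightarrow> ('h \<Rightarrow> 'h) \<Rightarrow> 'h set" where
  "adjoint_domain D Y = {y. \<exists>z. \<forall>x\<in>D. cinner (Y x) y = cinner x z}"

end

theory Submission
  imports Defs
begin

text \<open>Write \<open>A j = \<pi> (X j)\<close> and \<open>\<partial>\<close> for the derivation. Since \<open>P\<^sub>1\<close> has rank one,
  \<open>\<langle>P\<^sub>1, \<partial> p\<rangle> = \<langle>\<Omega>, (\<partial> p) \<Omega>\<rangle>\<close>. An operator \<open>Y\<close> with \<open>Y \<Omega> = 0\<close> and \<open>[Y, A j] = T j\<close> must send \<open>p \<Omega>\<close>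
  to \<open>(\<partial> p) \<Omega>\<close>, so \<open>Y\<^sup>* \<Omega>\<close> represents the functional in (a). Conversely, given \<open>\<xi>\<close>, the Leibniz rule
  yields \<open>\<langle>(\<partial> p) \<Omega>, q \<Omega>\<rangle> = \<langle>p \<Omega>, q \<xi> - (\<partial> q\<^sup>*)\<^sup>* \<Omega>\<rangle>\<close>. As the vectors \<open>q \<Omega>\<close> are dense, \<open>p \<Omega> \<mapsto> (\<partial> p) \<Omega>\<close>
  is well defined and closable.

  Density of the polynomial vectors combines two facts. Ultraweak continuity of \<open>\<tau>\<close> bounds
  \<open>\<tau> (b\<^sup>* b)\<close> by \<open>\<Sum>\<^sub>i \<parallel>b z\<^sub>i\<parallel>\<^sup>2\<close> for some square-summable \<open>z\<close>, and von Neumann's density theorem on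
  square-summable sequences approximates every element of the bicommutant by polynomials with
  respect to this seminorm.\<close>

section \<open>Complex Hilbert spaces\<close>

lemma cinner_add_right: "cinner x (y + z) = cinner x y + cinner x (z::'a::chilbert_space)"
  by (metis cinner_add_left cinner_commute complex_cnj_add)

lemma cinner_scaleC_right: "cinner x (c *\<^sub>C y) = cnj c * cinner x (y::'a::chilbert_space)"
  by (metis cinner_scaleC_left cinner_commute complex_cnj_mult)

lemma cinner_zero_left [simp]: "cinner 0 (x::'a::chilbert_space) = 0"
  using cinner_add_left[of 0 0 x] by simp

lemma cinner_zero_right [simp]: "cinner (x::'a::chilbert_space) 0 = 0"
  using cinner_add_right[of x 0 0] by simp

lemma cinner_minus_left: "cinner (- x) (y::'a::chilbert_space) = - cinner x y"
  using cinner_add_left[of x "- x" y] by (simp add: eq_neg_iff_add_eq_0 add.commute)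

lemma cinner_minus_right: "cinner (x::'a::chilbert_space) (- y) = - cinner x y"
  using cinner_add_right[of x y "- y"] by (simp add: eq_neg_iff_add_eq_0 add.commute)

lemma cinner_diff_left: "cinner (x - y) (z::'a::chilbert_space) = cinner x z - cinner y z"
  using cinner_add_left[of x "- y" z] by (simp add: cinner_minus_left)

lemma cinner_diff_right: "cinner (x::'a::chilbert_space) (y - z) = cinner x y - cinner x z"
  using cinner_add_right[of x y "- z"] by (simp add: cinner_minus_right)

lemma cinner_sum_left: "cinner (\<Sum>i\<in>I. f i) (y::'a::chilbert_space) = (\<Sum>i\<in>I. cinner (f i) y)"
  by (induction I rule: infinite_finite_induct) (auto simp: cinner_add_left)

lemma cinner_sum_right: "cinner (y::'a::chilbert_space) (\<Sum>i\<in>I. f i) = (\<Sum>i\<in>I. cinner y (f i))"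
  by (induction I rule: infinite_finite_induct) (auto simp: cinner_add_right)

lemma Re_cinner_self: "Re (cinner x x) = (norm (x::'a::chilbert_space))\<^sup>2"
proof -
  have "0 \<le> Re (cinner x x)"
    using norm_ge_zero[of x] by (simp add: norm_eq_sqrt_cinner)
  then show ?thesis
    by (simp add: norm_eq_sqrt_cinner)
qed

lemma cinner_self: "cinner x x = complex_of_real ((norm (x::'a::chilbert_space))\<^sup>2)"
proof -
  have "Im (cinner x x) = 0"
    using arg_cong[OF cinner_commute[of x x], of Im] by simp
  then show ?thesis
    by (simp add: complex_eq_iff Re_cinner_self)
qed

lemma cinner_self_eq_0_iff [simp]: "cinner x x = 0 \<longleftrightarrow> x = (0::'a::chilbert_space)"
  by (simp add: cinner_self)

lemma norm_scaleC: "norm (c *\<^sub>C x) = cmod c * norm (x::'a::chilbert_space)"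
proof -
  have "cinner (c *\<^sub>C x) (c *\<^sub>C x) = (c * cnj c) * cinner x x"
    by (simp add: cinner_scaleC_left cinner_scaleC_right)
  also have "\<dots> = complex_of_real ((cmod c * norm x)\<^sup>2)"
    by (simp only: cinner_self complex_norm_square[symmetric] of_real_mult of_real_power
        power_mult_distrib)
  finally have "(norm (c *\<^sub>C x))\<^sup>2 = (cmod c * norm x)\<^sup>2"
    by (metis Re_cinner_self Re_complex_of_real)
  then show ?thesis
    by (simp add: power2_eq_iff_nonneg)
qed

text \<open>Pythagoras: removing from \<open>x\<close> its component along \<open>y\<close> leaves a
  vector orthogonal to \<open>y\<close>. Nonnegativity of the left side gives Cauchy-Schwarz, and
  the exact decrease drives the variational step of the projection theorem.\<close>

lemma norm_minus_proj:
  fixes x y :: "'a::chilbert_space"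
  assumes "y \<noteq> 0"
  shows "(norm (x - (cinner x y / complex_of_real ((norm y)\<^sup>2)) *\<^sub>C y))\<^sup>2 =
    (norm x)\<^sup>2 - (cmod (cinner x y))\<^sup>2 / (norm y)\<^sup>2"
proof -
  define c where "c = cinner x y / complex_of_real ((norm y)\<^sup>2)"
  have cy: "c * complex_of_real ((norm y)\<^sup>2) = cinner x y"
    using assms by (simp add: c_def)
  have sq: "cinner x y * cnj (cinner x y) = complex_of_real ((cmod (cinner x y))\<^sup>2)"
    by (rule complex_norm_square[symmetric])
  have "cinner (x - c *\<^sub>C y) y = 0"
    by (simp add: cinner_diff_left cinner_scaleC_left cinner_self[of y] cy del: of_real_power)
  then have "cinner (x - c *\<^sub>C y) (x - c *\<^sub>C y) = cinner x x - c * cinner y x"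
    by (simp add: cinner_diff_right cinner_scaleC_right cinner_diff_left cinner_scaleC_left)
  also have "\<dots> = complex_of_real ((norm x)\<^sup>2 - (cmod (cinner x y))\<^sup>2 / (norm y)\<^sup>2)"
    unfolding c_def cinner_self[of x] cinner_commute[of y x]
    using sq by (simp add: field_simps)
  finally show ?thesis
    unfolding c_def[symmetric] by (metis Re_cinner_self Re_complex_of_real)
qed

lemma cinner_Cauchy_Schwarz: "cmod (cinner x y) \<le> norm x * norm (y::'a::chilbert_space)"
proof (cases "y = 0")
  case False
  have "(cmod (cinner x y))\<^sup>2 / (norm y)\<^sup>2 \<le> (norm x)\<^sup>2"
    using norm_minus_proj[OF False, of x] by (smt (verit) zero_le_power2)
  then have "(cmod (cinner x y))\<^sup>2 \<le> (norm x * norm y)\<^sup>2"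
    using False by (simp add: field_simps)
  then show ?thesis
    by (rule power2_le_imp_le) simp
qed simp

lemma scaleC_scaleR: "c *\<^sub>C (r *\<^sub>R x) = r *\<^sub>R (c *\<^sub>C (x::'a::chilbert_space))"
  by (simp add: scaleC_of_real[symmetric] scaleC_scaleC mult.commute)

lemma cinner_scaleR_left: "cinner (r *\<^sub>R x) y = complex_of_real r * cinner (x::'a::chilbert_space) y"
  by (metis scaleC_of_real cinner_scaleC_left)

lemma cinner_scaleR_right: "cinner x (r *\<^sub>R y) = complex_of_real r * cinner (x::'a::chilbert_space) y"
  by (metis scaleC_of_real cinner_scaleC_right complex_cnj_complex_of_real)

lemma bounded_linear_cinner_left: "bounded_linear (\<lambda>x. cinner x (y::'a::chilbert_space))"
  by (rule bounded_linear_intro[of _ "norm y"])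
    (auto simp: cinner_add_left cinner_scaleR_left scaleR_conv_of_real cinner_Cauchy_Schwarz)

lemma bounded_linear_cinner_right: "bounded_linear (\<lambda>y. cinner (x::'a::chilbert_space) y)"
  by (rule bounded_linear_intro[of _ "norm x"])
    (auto simp: cinner_add_right cinner_scaleR_right scaleR_conv_of_real
      cinner_Cauchy_Schwarz mult.commute[of "norm _" "norm x"])

lemma bounded_linear_scaleC: "bounded_linear (\<lambda>x. c *\<^sub>C (x::'a::chilbert_space))"
  by (rule bounded_linear_intro[of _ "cmod c"])
    (auto simp: scaleC_add_right scaleC_scaleR norm_scaleC)

lemma cinner_eqI:
  assumes "\<And>z. cinner x z = cinner y (z::'a::chilbert_space)"
  shows "x = y"
proof -
  have "cinner (x - y) (x - y) = 0"
    using assms by (simp add: cinner_diff_left)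
  then show ?thesis by simp
qed

text \<open>The orthogonal complement of \<open>x\<close> is closed and contains \<open>S\<close>,
  hence is the whole space and contains \<open>x\<close> itself.\<close>

lemma orthogonal_dense_eq_0:
  assumes "closure S = UNIV" "\<And>s. s \<in> S \<Longrightarrow> cinner x s = 0"
  shows "x = (0::'a::chilbert_space)"
proof -
  have "closed {y. cinner x y = 0}"
    by (intro closed_Collect_eq continuous_intros
        linear_continuous_on bounded_linear_cinner_right)
  then have "closure S \<subseteq> {y. cinner x y = 0}"
    using assms(2) by (intro closure_minimal) auto
  then have "x \<in> {y. cinner x y = 0}"
    unfolding assms(1) by blast
  then show ?thesis by simp
qed

section \<open>The projection theorem and Riesz representation\<close>

lemma parallelogram_law:
  "(norm (x + y))\<^sup>2 + (norm (x - y))\<^sup>2 = 2 * (norm x)\<^sup>2 + 2 * (norm (y::'a::chilbert_space))\<^sup>2"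
  by (simp add: Re_cinner_self[symmetric] cinner_add_left cinner_add_right
      cinner_diff_left cinner_diff_right)

text \<open>A minimizing sequence for the distance from \<open>x\<close> to \<open>E\<close> is
  Cauchy by the parallelogram law. Its limit is a nearest point, and minimality forces the residual
  to be orthogonal to \<open>E\<close>.\<close>

lemma closed_subspace_projection:
  fixes E :: "'a::chilbert_space set"
  assumes sub: "complex_vector.subspace E" and cl: "closed E"
  shows "\<exists>y\<in>E. \<forall>z\<in>E. cinner (x - y) z = 0"
proof -
  have ne: "E \<noteq> {}"
    using complex_vector.subspace_0[OF sub] by auto
  define d where "d = infdist x E"
  have d0: "0 \<le> d"
    by (simp add: d_def infdist_nonneg)
  have lower: "d\<^sup>2 \<le> (norm (x - y))\<^sup>2" if "y \<in> E" for y
    using infdist_le[OF that, of x] d0 by (auto simp: d_def dist_norm intro: power_mono)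
  have "\<exists>y\<in>E. (norm (x - y))\<^sup>2 < d\<^sup>2 + 1 / Suc n" for n
  proof -
    have "d < sqrt (d\<^sup>2 + 1 / Suc n)"
      by (rule real_less_rsqrt) simp
    then obtain y where "y \<in> E" "dist x y < sqrt (d\<^sup>2 + 1 / Suc n)"
      using ne cINF_less_iff[of E "dist x"] by (auto simp: d_def infdist_notempty)
    moreover have "(dist x y)\<^sup>2 < (sqrt (d\<^sup>2 + 1 / Suc n))\<^sup>2"
      using calculation(2) by (intro power_strict_mono) auto
    ultimately show ?thesis
      by (auto simp: dist_norm)
  qed
  then obtain y where yE: "\<And>n. y n \<in> E" and yn: "\<And>n. (norm (x - y n))\<^sup>2 < d\<^sup>2 + 1 / Suc n"
    by metis
  have close: "(norm (y m - y n))\<^sup>2 \<le> 4 / Suc k" if "k \<le> m" "k \<le> n" for m n k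
  proof -
    \<comment> \<open>The midpoint is at distance at least \<open>d\<close> from \<open>x\<close>,
      so the parallelogram law leaves little room for \<open>y m - y n\<close>.\<close>
    have "(1/2) *\<^sub>R (y m + y n) \<in> E"
      using sub yE by (metis complex_vector.subspace_def scaleC_of_real)
    from lower[OF this] have "4 * d\<^sup>2 \<le> (norm (2 *\<^sub>R (x - (1/2) *\<^sub>R (y m + y n))))\<^sup>2"
      by (simp only: norm_scaleR power_mult_distrib) simp
    also have "2 *\<^sub>R (x - (1/2) *\<^sub>R (y m + y n)) = (x - y n) + (x - y m)"
      by (simp add: scaleR_diff_right scaleR_2)
    finally have "4 * d\<^sup>2 + (norm (y m - y n))\<^sup>2 \<le> 2 * (norm (x - y n))\<^sup>2 + 2 * (norm (x - y m))\<^sup>2"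
      using parallelogram_law[of "x - y n" "x - y m"] by simp
    moreover have "1 / real (Suc m) \<le> 1 / Suc k" "1 / real (Suc n) \<le> 1 / Suc k"
      using that by (auto intro!: divide_left_mono)
    moreover have "4 / real (Suc k) = 4 * (1 / Suc k)" by simp
    ultimately show ?thesis
      using yn[of m] yn[of n] by linarith
  qed
  have "Cauchy y"
  proof (rule metric_CauchyI)
    fix e :: real assume "0 < e"
    then obtain k where k: "1 / Suc k < e\<^sup>2 / 4"
      using nat_approx_posE[of "e\<^sup>2 / 4"] by auto
    have "dist (y m) (y n) < e" if "k \<le> m" "k \<le> n" for m n
    proof (rule power2_less_imp_less)
      show "(dist (y m) (y n))\<^sup>2 < e\<^sup>2"
        using close[OF that] k by (simp add: dist_norm)
    qed (use \<open>0 < e\<close> in simp)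
    then show "\<exists>M. \<forall>m\<ge>M. \<forall>n\<ge>M. dist (y m) (y n) < e" by blast
  qed
  then obtain l where l: "y \<longlonglongrightarrow> l"
    by (auto simp: Cauchy_convergent_iff convergent_def)
  have lE: "l \<in> E"
    using closed_sequentially[OF cl] yE l by blast
  have "(\<lambda>n. (norm (x - y n))\<^sup>2) \<longlonglongrightarrow> (norm (x - l))\<^sup>2"
    by (intro tendsto_intros l)
  moreover have "(\<lambda>n. d\<^sup>2 + 1 / Suc n) \<longlonglongrightarrow> d\<^sup>2 + 0"
    by (intro tendsto_intros LIMSEQ_Suc[OF lim_const_over_n])
  moreover have "(norm (x - y n))\<^sup>2 \<le> d\<^sup>2 + 1 / Suc n" for n
    using yn[of n] by (rule less_imp_le)
  ultimately have "(norm (x - l))\<^sup>2 \<le> d\<^sup>2 + 0"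
    by (intro LIMSEQ_le) auto
  then have upper: "(norm (x - l))\<^sup>2 \<le> d\<^sup>2"
    by simp
  have "cinner (x - l) z = 0" if "z \<in> E" for z
  proof (cases "z = 0")
    case False
    \<comment> \<open>The optimal step from \<open>l\<close> in direction \<open>z\<close>: by
      \<open>norm_minus_proj\<close> it would shorten the distance strictly unless the inner product
      vanishes.\<close>
    define c where "c = cinner (x - l) z / complex_of_real ((norm z)\<^sup>2)"
    have "l + c *\<^sub>C z \<in> E"
      using lE that sub by (auto simp: complex_vector.subspace_def)
    from lower[OF this] have "d\<^sup>2 \<le> (norm (x - l))\<^sup>2 - (cmod (cinner (x - l) z))\<^sup>2 / (norm z)\<^sup>2"
      unfolding norm_minus_proj[OF False, symmetric] c_def by (simp add: diff_diff_eq)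
    then have "(cmod (cinner (x - l) z))\<^sup>2 / (norm z)\<^sup>2 \<le> 0"
      using upper by linarith
    then show ?thesis
      using False by (simp add: divide_le_0_iff)
  qed simp
  then show ?thesis
    using lE by blast
qed

text \<open>For nonzero \<open>f\<close>, the projection theorem gives a vector \<open>u\<close>
  orthogonal to the kernel with \<open>f u\<close> nonzero. Every \<open>v\<close> differs from a
  multiple of \<open>u\<close> by a kernel vector, so a rescaled \<open>u\<close> represents
  \<open>f\<close>.\<close>

lemma Riesz_representation:
  fixes f :: "'a::chilbert_space \<Rightarrow> complex"
  assumes bl: "bounded_linear f" and sc: "\<And>c x. f (c *\<^sub>C x) = c * f x"
  shows "\<exists>z. \<forall>x. f x = cinner x z"
proof (cases "\<forall>x. f x = 0")
  case False
  then obtain x where x: "f x \<noteq> 0" by blast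
  interpret f: bounded_linear f by (fact bl)
  have "closed {x. f x = 0}"
    by (intro closed_Collect_eq continuous_intros linear_continuous_on bl)
  moreover have "complex_vector.subspace {x. f x = 0}"
    by (auto simp: complex_vector.subspace_def f.add sc f.zero)
  ultimately obtain y where y: "f y = 0" and orth: "\<And>z. f z = 0 \<Longrightarrow> cinner (x - y) z = 0"
    using closed_subspace_projection[of "{x. f x = 0}" x] by auto
  define u where "u = x - y"
  have fu: "f u \<noteq> 0"
    using x y by (simp add: u_def f.diff)
  then have u: "cinner u u \<noteq> 0"
    by (auto simp: f.zero)
  have "f v = cinner v (cnj (f u / cinner u u) *\<^sub>C u)" for v
  proof -
    have "f (v - (f v / f u) *\<^sub>C u) = 0"
      using fu by (simp add: f.diff sc)
    from orth[OF this] have "cinner (v - (f v / f u) *\<^sub>C u) u = 0"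
      by (metis cinner_commute complex_cnj_zero u_def)
    then have "cinner v u = f v / f u * cinner u u"
      by (simp add: cinner_diff_left cinner_scaleC_left)
    then show ?thesis
      using fu u by (simp add: cinner_scaleC_right)
  qed
  then show ?thesis by blast
qed (auto intro: exI[of _ 0])

section \<open>Bounded operators and their adjoints\<close>

lemma bounded_clinear_add: "bounded_clinear a \<Longrightarrow> a (x + y) = a x + a y"
  by (simp add: bounded_clinear_def bounded_linear.linear linear_add)

lemma bounded_clinear_diff: "bounded_clinear a \<Longrightarrow> a (x - y) = a x - a y"
  by (simp add: bounded_clinear_def bounded_linear.linear linear_diff)

lemma bounded_clinear_zero: "bounded_clinear a \<Longrightarrow> a 0 = 0"
  by (simp add: bounded_clinear_def bounded_linear.linear linear_0)

lemma bounded_clinear_sum: "bounded_clinear a \<Longrightarrow> a (\<Sum>i\<in>I. f i) = (\<Sum>i\<in>I. a (f i))"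
  by (simp add: bounded_clinear_def bounded_linear.linear linear_sum)

lemma bounded_clinear_scaleC: "bounded_clinear a \<Longrightarrow> a (c *\<^sub>C x) = c *\<^sub>C a x"
  by (simp add: bounded_clinear_def)

lemma bounded_clinear_id: "bounded_clinear id"
  by (simp add: bounded_clinear_def id_def)

lemma bounded_clinear_0: "bounded_clinear (\<lambda>x. 0)"
  by (simp add: bounded_clinear_def)

lemma bounded_clinear_add_fun:
  "bounded_clinear a \<Longrightarrow> bounded_clinear b \<Longrightarrow> bounded_clinear (\<lambda>x. a x + b x)"
  by (simp add: bounded_clinear_def bounded_linear_add scaleC_add_right)

lemma bounded_clinear_sum_fun:
  "(\<And>i. i \<in> I \<Longrightarrow> bounded_clinear (a i)) \<Longrightarrow> bounded_clinear (\<lambda>x. \<Sum>i\<in>I. a i x)"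
  by (induction I rule: infinite_finite_induct)
    (auto simp: bounded_clinear_0 intro: bounded_clinear_add_fun)

lemma bounded_clinear_scaleC_fun:
  "bounded_clinear a \<Longrightarrow> bounded_clinear (\<lambda>x. c *\<^sub>C a x)"
  using bounded_linear_compose[OF bounded_linear_scaleC, of a c]
  by (simp add: bounded_clinear_def scaleC_scaleC mult.commute)

lemma bounded_clinear_comp:
  "bounded_clinear a \<Longrightarrow> bounded_clinear b \<Longrightarrow> bounded_clinear (a \<circ> b)"
  using bounded_linear_compose[of a b] by (simp add: bounded_clinear_def o_def)

lemma bounded_clinear_intro:
  assumes "\<And>x y. a (x + y) = a x + a y" "\<And>c x. a (c *\<^sub>C x) = c *\<^sub>C a x"
    and "\<And>x. norm (a x) \<le> norm x * K"
  shows "bounded_clinear a"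
proof -
  have "a (r *\<^sub>R x) = r *\<^sub>R a x" for r x
    by (metis assms(2) scaleC_of_real)
  then show ?thesis
    using assms by (auto simp: bounded_clinear_def intro!: bounded_linear_intro)
qed

lemma cadj_eqI:
  assumes "\<And>x y. cinner (a x) y = cinner x (b y)"
  shows "cadj a = b"
  unfolding cadj_def
proof (rule the_equality)
  fix b' assume b': "\<forall>x y. cinner (a x) y = cinner x (b' y)"
  show "b' = b"
  proof
    fix y
    have "cinner x (b' y) = cinner x (b y)" for x
      using b' assms by metis
    then have "cinner (b' y) x = cinner (b y) x" for x
      by (metis cinner_commute)
    then show "b' y = b y" by (rule cinner_eqI)
  qed
qed (use assms in blast)

text \<open>Riesz representation supplies an operator satisfying the description in
  \<open>cadj\<close>, and \<open>cadj_eqI\<close> identifies it with \<open>cadj a\<close>.\<close>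

lemma cinner_cadj:
  assumes "bounded_clinear a"
  shows "cinner (a x) y = cinner x (cadj a y)"
proof -
  have "\<exists>z. \<forall>x. cinner (a x) y = cinner x z" for y
    using assms bounded_linear_compose[OF bounded_linear_cinner_left, of a y]
    by (intro Riesz_representation) (auto simp: bounded_clinear_def cinner_scaleC_left)
  then obtain b where "\<And>x y. cinner (a x) y = cinner x (b y)"
    by metis
  with cadj_eqI[of a b] show ?thesis by simp
qed

lemma cinner_cadj':
  assumes "bounded_clinear a"
  shows "cinner x (a y) = cinner (cadj a x) y"
  by (metis assms cinner_cadj cinner_commute)

lemma bounded_clinear_cadj:
  assumes a: "bounded_clinear a"
  shows "bounded_clinear (cadj a)"
proof -
  obtain K where K: "\<And>x. norm (a x) \<le> norm x * K" "0 \<le> K"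
    using a bounded_linear.nonneg_bounded[of a] by (auto simp: bounded_clinear_def)
  show ?thesis
  proof (rule bounded_clinear_intro[of _ K])
    fix x
    \<comment> \<open>Estimating this by the bound \<open>K\<close> of \<open>a\<close> and
      cancelling one factor \<open>norm (cadj a x)\<close> shows that the adjoint has the same
      bound.\<close>
    have "(norm (cadj a x))\<^sup>2 = cmod (cinner (a (cadj a x)) x)"
      unfolding cinner_cadj[OF a] cinner_self by (simp only: norm_of_real abs_power2)
    also have "\<dots> \<le> norm (cadj a x) * K * norm x"
      using cinner_Cauchy_Schwarz[of "a (cadj a x)" x] K(1)[of "cadj a x"]
      by (meson mult_right_mono norm_ge_zero order_trans)
    finally show "norm (cadj a x) \<le> norm x * K"
      using K(2) by (cases "cadj a x = 0") (auto simp: power2_eq_square mult_ac)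
  qed (rule cinner_eqI,
      simp add: cinner_cadj'[OF a, symmetric] cinner_add_left cinner_scaleC_left)+
qed

section \<open>Orthogonal projections, orthonormal expansions and the pairing with a rank-one
  projection\<close>

lemma orth_proj_eqI:
  assumes "complex_vector.subspace S" "y \<in> S" "\<And>z. z \<in> S \<Longrightarrow> cinner (x - y) z = 0"
  shows "orth_proj S x = y"
  unfolding orth_proj_def
proof (rule the_equality)
  fix y' assume y': "y' \<in> S \<and> (\<forall>z\<in>S. cinner (x - y') z = 0)"
  have "y' - y \<in> S"
    using y' assms by (simp add: complex_vector.subspace_diff)
  then have "cinner (x - y) (y' - y) - cinner (x - y') (y' - y) = 0"
    using y' assms by simp
  then have "cinner (y' - y) (y' - y) = 0"
    by (simp add: cinner_diff_left[symmetric])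
  then show "y' = y" by simp
qed (use assms in blast)

lemma orth_proj_closed:
  assumes "complex_vector.subspace S" "closed S"
  shows "orth_proj S x \<in> S" "z \<in> S \<Longrightarrow> cinner (x - orth_proj S x) z = 0"
proof -
  obtain y where y: "y \<in> S" "\<forall>z\<in>S. cinner (x - y) z = 0"
    using closed_subspace_projection[OF assms] by blast
  then have "orth_proj S x = y"
    using orth_proj_eqI[OF assms(1)] by blast
  with y show "orth_proj S x \<in> S" "z \<in> S \<Longrightarrow> cinner (x - orth_proj S x) z = 0"
    by auto
qed

lemma orth_proj_unit_vector:
  assumes "cinner u u = 1"
  shows "orth_proj (complex_vector.span {u}) x = cinner x u *\<^sub>C u"
proof (rule orth_proj_eqI)
  fix z assume "z \<in> complex_vector.span {u}"
  then obtain c where "z = c *\<^sub>C u"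
    using complex_vector.span_breakdown[of u "{u}" z] by auto
  then show "cinner (x - cinner x u *\<^sub>C u) z = 0"
    using assms by (simp add: cinner_scaleC_right cinner_diff_left cinner_scaleC_left)
qed (auto intro: complex_vector.span_scale complex_vector.span_base)

text \<open>Partial sums of the expansion are best approximations from finite spans, so density of the
  span already gives unconditional convergence.\<close>

lemma orthonormal_basis_expansion:
  assumes B: "orthonormal_basis B"
  shows "((\<lambda>e. cinner x e *\<^sub>C e) has_sum x) B"
proof -
  have on: "cinner e f = (if e = f then 1 else 0)" if "e \<in> B" "f \<in> B" for e f
    using B that by (auto simp: orthonormal_basis_def)
  have best: "norm (x - (\<Sum>e\<in>F. cinner x e *\<^sub>C e)) \<le> norm (x - (\<Sum>e\<in>F. c e *\<^sub>C e))"
    if F: "finite F" "F \<subseteq> B" for F and c :: "'a \<Rightarrow> complex"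
  proof -
    \<comment> \<open>The residual \<open>r\<close> is orthogonal to the span of \<open>F\<close>,
      where \<open>s\<close> lies; changing the coefficients to \<open>c\<close> replaces
      \<open>r\<close> by \<open>r + s\<close>, which is no shorter.\<close>
    define r where "r = x - (\<Sum>e\<in>F. cinner x e *\<^sub>C e)"
    define s where "s = (\<Sum>e\<in>F. (cinner x e - c e) *\<^sub>C e)"
    have "cinner r f = 0" if "f \<in> F" for f
    proof -
      have "(\<Sum>e\<in>F. cinner x e * cinner e f) = (\<Sum>e\<in>F. if e = f then cinner x e else 0)"
        using F that by (intro sum.cong) (auto simp: on subset_iff)
      also have "\<dots> = cinner x f"
        using F that by (simp add: sum.delta)
      finally show ?thesis
        by (simp add: r_def cinner_diff_left cinner_sum_left cinner_scaleC_left)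
    qed
    then have rs: "cinner r s = 0"
      by (simp add: s_def cinner_sum_right cinner_scaleC_right)
    then have sr: "cinner s r = 0"
      by (metis cinner_commute complex_cnj_zero)
    have "(norm (r + s))\<^sup>2 = (norm r)\<^sup>2 + (norm s)\<^sup>2"
      by (simp add: Re_cinner_self[symmetric] cinner_add_left cinner_add_right rs sr)
    then have "norm r \<le> norm (r + s)"
      by (auto intro: power2_le_imp_le)
    moreover have "r + s = x - (\<Sum>e\<in>F. c e *\<^sub>C e)"
      by (simp add: r_def s_def complex_vector.scale_left_diff_distrib sum_subtractf)
    ultimately show ?thesis
      unfolding r_def by metis
  qed
  show ?thesis
    unfolding has_sum_def tendsto_iff eventually_finite_subsets_at_top
  proof (intro allI impI)
    fix \<epsilon> :: real assume "0 < \<epsilon>"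
    have "x \<in> closure (complex_vector.span B)"
      using B by (simp add: orthonormal_basis_def)
    then obtain u where u: "u \<in> complex_vector.span B" "dist u x < \<epsilon>"
      using \<open>0 < \<epsilon>\<close> by (auto simp: closure_approachable)
    then obtain t c where t: "finite t" "t \<subseteq> B" "u = (\<Sum>e\<in>t. c e *\<^sub>C e)"
      by (auto simp: complex_vector.span_explicit)
    have "dist (\<Sum>e\<in>F. cinner x e *\<^sub>C e) x < \<epsilon>" if F: "finite F" "t \<subseteq> F" "F \<subseteq> B" for F
    proof -
      \<comment> \<open>Extending the coefficients of \<open>u\<close> by zero makes
        \<open>u\<close> a competitor over every finite \<open>F\<close> containing
        \<open>t\<close>.\<close>
      have "u = (\<Sum>e\<in>F. (if e \<in> t then c e else 0) *\<^sub>C e)"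
        unfolding t(3) using F by (intro sum.mono_neutral_cong_left) auto
      with best[OF F(1,3), of "\<lambda>e. if e \<in> t then c e else 0"] u(2) show ?thesis
        by (simp add: dist_norm norm_minus_commute)
    qed
    with t show "\<exists>X. finite X \<and> X \<subseteq> B \<and> (\<forall>Y. finite Y \<and> X \<subseteq> Y \<and> Y \<subseteq> B \<longrightarrow>
        dist (\<Sum>e\<in>Y. cinner x e *\<^sub>C e) x < \<epsilon>)"
      by blast
  qed
qed

text \<open>The bounded functional \<open>\<lambda>x. cinner x y\<close> is applied term by term to
  the expansion of \<open>x\<close>.\<close>

lemma orthonormal_basis_Parseval:
  assumes "orthonormal_basis B"
  shows "((\<lambda>e. cinner x e * cinner e y) has_sum cinner x y) B"
  using has_sum_bounded_linear[OF bounded_linear_cinner_left orthonormal_basis_expansion[OF assms],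
      of x y]
  by (simp add: o_def cinner_scaleC_left)

text \<open>Expanding the trace in a basis turns it into the Parseval series for
  \<open>cadj S u\<close> and \<open>u\<close>. This reduces the Hilbert-Schmidt pairing with the
  projection to an inner product of vectors.\<close>

lemma hs_inner_rank_one:
  fixes u :: "'a::chilbert_space"
  assumes u: "cinner u u = 1" and S: "bounded_clinear S"
    and ex: "orthonormal_basis (B0 :: 'a set)"
  shows "hs_inner (orth_proj (complex_vector.span {u})) S = cinner u (S u)"
proof -
  define B where "B = (SOME B :: 'a set. orthonormal_basis B)"
  \<comment> \<open>The trace is taken over a basis picked by \<open>SOME\<close>; the hypothesis
    \<open>ex\<close> guarantees that the choice really is one.\<close>
  have B: "orthonormal_basis B"
    unfolding B_def using ex by (rule someI)
  have "cinner (cadj S (cinner e u *\<^sub>C u)) e = cinner (cadj S u) e * cinner e u" for e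
    by (simp add: cinner_cadj'[OF S, symmetric] cinner_scaleC_left)
  then have "hs_inner (orth_proj (complex_vector.span {u})) S =
      (\<Sum>\<^sub>\<infinity>e\<in>B. cinner (cadj S u) e * cinner e u)"
    by (simp add: hs_inner_def op_trace_def B_def orth_proj_unit_vector[OF u])
  also have "\<dots> = cinner (cadj S u) u"
    using orthonormal_basis_Parseval[OF B] by (rule infsumI)
  finally show ?thesis
    by (simp add: cinner_cadj'[OF S])
qed

section \<open>Projections onto closed subspaces as operators\<close>

lemma subspace_closure:
  fixes V :: "'a::chilbert_space set"
  assumes "complex_vector.subspace V"
  shows "complex_vector.subspace (closure V)"
proof (rule complex_vector.subspaceI)
  show "0 \<in> closure V"
    using complex_vector.subspace_0[OF assms] closure_subset by blast
next
  fix x y assume "x \<in> closure V" "y \<in> closure V"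
  then obtain f g where "\<forall>n. f n \<in> V" "f \<longlonglongrightarrow> x" "\<forall>n. g n \<in> V" "g \<longlonglongrightarrow> y"
    unfolding closure_sequential by blast
  then have "\<forall>n. f n + g n \<in> V" "(\<lambda>n. f n + g n) \<longlonglongrightarrow> x + y"
    by (auto intro: tendsto_add complex_vector.subspace_add[OF assms])
  then show "x + y \<in> closure V"
    unfolding closure_sequential by (intro exI[of _ "\<lambda>n. f n + g n"]) blast
next
  fix c x assume x: "x \<in> closure V"
  have "(\<lambda>x. c *\<^sub>C x) ` closure V \<subseteq> closure V"
  proof (rule image_closure_subset)
    show "continuous_on (closure V) (\<lambda>x. c *\<^sub>C x)"
      by (rule linear_continuous_on[OF bounded_linear_scaleC])
    show "(\<lambda>x. c *\<^sub>C x) ` V \<subseteq> closure V"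
      using complex_vector.subspace_scale[OF assms] closure_subset by blast
  qed simp
  with x show "c *\<^sub>C x \<in> closure V" by blast
qed

text \<open>Both sides equal the inner product of the two projections, since each residual is
  orthogonal to \<open>E\<close>.\<close>

lemma cinner_orth_proj:
  assumes "complex_vector.subspace E" "closed E"
  shows "cinner (orth_proj E x) y = cinner x (orth_proj E y)"
proof -
  have *: "cinner (x - orth_proj E x) (orth_proj E y) = 0" for x y
    using orth_proj_closed[OF assms] by blast
  have "cinner (orth_proj E x) (y - orth_proj E y) = 0"
    using *[of y x] by (metis cinner_commute complex_cnj_zero)
  with *[of x y] show ?thesis
    by (simp add: cinner_diff_left cinner_diff_right)
qed

lemma bounded_clinear_orth_proj:
  assumes E: "complex_vector.subspace E" "closed E"
  shows "bounded_clinear (orth_proj E)"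
proof (rule bounded_clinear_intro[of _ 1])
  fix x
  have "orth_proj E (orth_proj E x) = orth_proj E x"
    by (rule orth_proj_eqI[OF E(1)]) (use orth_proj_closed[OF E] in auto)
  then have "(norm (orth_proj E x))\<^sup>2 = cmod (cinner x (orth_proj E x))"
    using cinner_orth_proj[OF E, of x "orth_proj E x"]
    by (metis cinner_self norm_of_real abs_power2)
  also have "\<dots> \<le> norm x * norm (orth_proj E x)"
    by (rule cinner_Cauchy_Schwarz)
  finally show "norm (orth_proj E x) \<le> norm x * 1"
    by (cases "orth_proj E x = 0") (auto simp: power2_eq_square)
qed (rule cinner_eqI, simp add: cinner_orth_proj[OF E] cinner_add_left cinner_scaleC_left)+

text \<open>Invariance under \<open>a\<close> keeps the image of the projection in \<open>E\<close>;
  invariance under \<open>cadj a\<close> keeps the image of the residual orthogonal to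
  \<open>E\<close>.\<close>

lemma orth_proj_commute:
  assumes E: "complex_vector.subspace E" "closed E" and a: "bounded_clinear a"
    and inv: "\<And>x. x \<in> E \<Longrightarrow> a x \<in> E" "\<And>x. x \<in> E \<Longrightarrow> cadj a x \<in> E"
  shows "orth_proj E (a x) = a (orth_proj E x)"
proof (rule orth_proj_eqI[OF E(1)])
  fix z assume "z \<in> E"
  then show "cinner (a x - a (orth_proj E x)) z = 0"
    unfolding bounded_clinear_diff[OF a, symmetric] cinner_cadj[OF a]
    using inv orth_proj_closed[OF E] by blast
qed (use inv orth_proj_closed[OF E] in blast)

section \<open>Square-summable sequences\<close>

text \<open>The Hilbert sum of countably many copies of \<open>'a\<close>. A square-summable
  sequence, which is the datum of an ultraweak seminorm, becomes a single vector, so approximation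
  at all its terms is approximation of one vector.\<close>

typedef (overloaded) ('a::chilbert_space) ell2 =
  "{f :: nat \<Rightarrow> 'a. summable (\<lambda>i. (norm (f i))\<^sup>2)}"
  morphisms entry Abs_ell2
  by (rule exI[of _ "\<lambda>i. 0"]) simp

lemma ell2_eqI: "(\<And>i. entry x i = entry y i) \<Longrightarrow> x = y"
  by (metis entry_inject ext)

lemma summable_entry: "summable (\<lambda>i. (norm (entry x i))\<^sup>2)"
  using entry[of x] by simp

lemma entry_Abs_ell2: "summable (\<lambda>i. (norm (f i))\<^sup>2) \<Longrightarrow> entry (Abs_ell2 f) = f"
  by (simp add: Abs_ell2_inverse)

text \<open>Minkowski's inequality on initial segments gives bounds independent of the length, hence
  both summability and the triangle inequality of \<open>ell2\<close>.\<close>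

lemma square_summable_add:
  fixes f g :: "nat \<Rightarrow> 'a::real_normed_vector"
  assumes f: "summable (\<lambda>i. (norm (f i))\<^sup>2)" and g: "summable (\<lambda>i. (norm (g i))\<^sup>2)"
  shows "summable (\<lambda>i. (norm (f i + g i))\<^sup>2)"
    and "sqrt (suminf (\<lambda>i. (norm (f i + g i))\<^sup>2)) \<le>
      sqrt (suminf (\<lambda>i. (norm (f i))\<^sup>2)) + sqrt (suminf (\<lambda>i. (norm (g i))\<^sup>2))"
proof -
  let ?s = "sqrt (suminf (\<lambda>i. (norm (f i))\<^sup>2)) + sqrt (suminf (\<lambda>i. (norm (g i))\<^sup>2))"
  have s0: "0 \<le> ?s"
    by (intro add_nonneg_nonneg real_sqrt_ge_zero suminf_nonneg f g) auto
  have fin: "(\<Sum>i<n. (norm (f i + g i))\<^sup>2) \<le> ?s\<^sup>2" for n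
  proof -
    have "L2_set (\<lambda>i. norm (f i + g i)) {..<n} \<le> L2_set (\<lambda>i. norm (f i) + norm (g i)) {..<n}"
      by (rule L2_set_mono) (auto intro: norm_triangle_ineq)
    also have "\<dots> \<le> L2_set (\<lambda>i. norm (f i)) {..<n} + L2_set (\<lambda>i. norm (g i)) {..<n}"
      by (rule L2_set_triangle_ineq)
    also have "\<dots> \<le> ?s"
      unfolding L2_set_def using f g
      by (intro add_mono real_sqrt_le_mono sum_le_suminf) auto
    finally have "(L2_set (\<lambda>i. norm (f i + g i)) {..<n})\<^sup>2 \<le> ?s\<^sup>2"
      by (rule power_mono) (rule L2_set_nonneg)
    then show ?thesis
      by (simp add: L2_set_def sum_nonneg)
  qed
  show s: "summable (\<lambda>i. (norm (f i + g i))\<^sup>2)"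
    by (rule summableI_nonneg_bounded[of _ "?s\<^sup>2"]) (use fin in auto)
  have "suminf (\<lambda>i. (norm (f i + g i))\<^sup>2) \<le> ?s\<^sup>2"
    by (rule suminf_le_const[OF s fin])
  then show "sqrt (suminf (\<lambda>i. (norm (f i + g i))\<^sup>2)) \<le> ?s"
    by (rule real_le_lsqrt[OF s0])
qed

lemma square_summable_scaleC:
  fixes f :: "nat \<Rightarrow> 'a::chilbert_space"
  assumes "summable (\<lambda>i. (norm (f i))\<^sup>2)"
  shows "summable (\<lambda>i. (norm (c *\<^sub>C f i))\<^sup>2)"
  using summable_mult[OF assms, of "(cmod c)\<^sup>2"] by (simp add: norm_scaleC power_mult_distrib)

lemma abs_cinner_le: "cmod (cinner x y) \<le> (norm x)\<^sup>2 + (norm (y::'a::chilbert_space))\<^sup>2"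
proof -
  have "0 \<le> (norm x - norm y)\<^sup>2" "0 \<le> (norm x)\<^sup>2" "0 \<le> (norm y)\<^sup>2" by simp_all
  then have "norm x * norm y \<le> (norm x)\<^sup>2 + (norm y)\<^sup>2"
    unfolding power2_diff by linarith
  with cinner_Cauchy_Schwarz[of x y] show ?thesis by linarith
qed

lemma summable_cinner:
  fixes f g :: "nat \<Rightarrow> 'a::chilbert_space"
  assumes "summable (\<lambda>i. (norm (f i))\<^sup>2)" "summable (\<lambda>i. (norm (g i))\<^sup>2)"
  shows "summable (\<lambda>i. cinner (f i) (g i))"
  by (rule summable_comparison_test'[OF summable_add[OF assms], of 0]) (simp add: abs_cinner_le)

instantiation ell2 :: (chilbert_space) real_vector
begin

definition "zero_ell2 = Abs_ell2 (\<lambda>i. 0 :: 'a)"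
definition "plus_ell2 x y = Abs_ell2 (\<lambda>i. entry x i + entry y i :: 'a)"
definition "uminus_ell2 x = Abs_ell2 (\<lambda>i. - entry x i :: 'a)"
definition "minus_ell2 x y = Abs_ell2 (\<lambda>i. entry x i - entry y i :: 'a)"
definition "scaleR_ell2 r x = Abs_ell2 (\<lambda>i. r *\<^sub>R entry x i :: 'a)"

lemma entry_zero [simp]: "entry (0 :: 'a ell2) i = 0"
  by (simp add: zero_ell2_def entry_Abs_ell2)

lemma entry_plus [simp]: "entry (x + y :: 'a ell2) i = entry x i + entry y i"
  by (simp add: plus_ell2_def entry_Abs_ell2 square_summable_add summable_entry)

lemma entry_uminus [simp]: "entry (- x :: 'a ell2) i = - entry x i"
  by (simp add: uminus_ell2_def entry_Abs_ell2 summable_entry)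

lemma entry_minus [simp]: "entry (x - y :: 'a ell2) i = entry x i - entry y i"
  using square_summable_add(1)[of "entry x" "entry (- y)"]
  by (simp add: minus_ell2_def entry_Abs_ell2 summable_entry)

lemma entry_scaleR [simp]: "entry (r *\<^sub>R x :: 'a ell2) i = r *\<^sub>R entry x i"
  by (simp add: scaleR_ell2_def entry_Abs_ell2 summable_entry power_mult_distrib summable_mult)

instance
proof
  fix x y z :: "'a ell2" and r s :: real
  show "x + y + z = x + (y + z)" "x + y = y + x" "0 + x = x" "- x + x = 0" "x - y = x + - y"
    "r *\<^sub>R (x + y) = r *\<^sub>R x + r *\<^sub>R y" "(r + s) *\<^sub>R x = r *\<^sub>R x + s *\<^sub>R x"
    "r *\<^sub>R s *\<^sub>R x = (r * s) *\<^sub>R x" "1 *\<^sub>R x = x"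
    by (rule ell2_eqI; simp add: algebra_simps)+
qed

end

instantiation ell2 :: (chilbert_space) real_normed_vector
begin

definition "norm_ell2 (x :: 'a ell2) = sqrt (suminf (\<lambda>i. (norm (entry x i))\<^sup>2))"
definition "dist_ell2 (x :: 'a ell2) y = norm (x - y)"
definition "sgn_ell2 (x :: 'a ell2) = x /\<^sub>R norm x"
definition "uniformity_ell2 =
  (INF e\<in>{0<..}. principal {(x :: 'a ell2, y). dist x y < e})"
definition "open_ell2 (U :: 'a ell2 set) \<longleftrightarrow>
  (\<forall>x\<in>U. \<forall>\<^sub>F (x', y) in uniformity. x' = x \<longrightarrow> y \<in> U)"

instance
proof
  fix x y :: "'a ell2" and r :: real
  show "norm x = 0 \<longleftrightarrow> x = 0"
  proof
    assume "norm x = 0"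
    then have "entry x i = 0" for i
      using suminf_eq_zero_iff[OF summable_entry[of x]] by (simp add: norm_ell2_def)
    then show "x = 0"
      by (intro ell2_eqI) simp
  qed (simp add: norm_ell2_def)
  show "norm (x + y) \<le> norm x + norm y"
    using square_summable_add(2)[OF summable_entry summable_entry, of x y]
    by (simp add: norm_ell2_def)
  show "norm (r *\<^sub>R x) = \<bar>r\<bar> * norm x"
    by (simp add: norm_ell2_def power_mult_distrib suminf_mult summable_entry real_sqrt_mult)
qed (fact dist_ell2_def sgn_ell2_def uniformity_ell2_def open_ell2_def)+

end

lemma norm_ell2_squared: "(norm (x :: 'a::chilbert_space ell2))\<^sup>2 = suminf (\<lambda>i. (norm (entry x i))\<^sup>2)"
  by (simp add: norm_ell2_def suminf_nonneg summable_entry)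

lemma norm_entry_le: "norm (entry x i) \<le> norm x"
proof (rule power2_le_imp_le)
  show "(norm (entry x i))\<^sup>2 \<le> (norm x)\<^sup>2"
    unfolding norm_ell2_squared
    using sum_le_suminf[OF summable_entry[of x], of "{i}"] by simp
qed simp

instance ell2 :: (chilbert_space) banach
proof
  fix X :: "nat \<Rightarrow> 'a ell2" assume X: "Cauchy X"
  have "Cauchy (\<lambda>n. entry (X n) i)" for i
  proof (rule metric_CauchyI)
    fix e :: real assume "0 < e"
    with X obtain N where "\<And>m n. m \<ge> N \<Longrightarrow> n \<ge> N \<Longrightarrow> dist (X m) (X n) < e"
      by (metis metric_CauchyD)
    then show "\<exists>N. \<forall>m\<ge>N. \<forall>n\<ge>N. dist (entry (X m) i) (entry (X n) i) < e"
      unfolding dist_norm entry_minus[symmetric] using norm_entry_le le_less_trans by blast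
  qed
  then obtain l where l: "\<And>i. (\<lambda>n. entry (X n) i) \<longlonglongrightarrow> l i"
    unfolding Cauchy_convergent_iff convergent_def by metis
  have tail: "\<exists>N. \<forall>n\<ge>N. summable (\<lambda>i. (norm (entry (X n) i - l i))\<^sup>2) \<and>
      suminf (\<lambda>i. (norm (entry (X n) i - l i))\<^sup>2) \<le> e\<^sup>2" if "0 < e" for e
  proof -
    obtain N where N: "\<And>m n. m \<ge> N \<Longrightarrow> n \<ge> N \<Longrightarrow> norm (X m - X n) < e"
      using X \<open>0 < e\<close> unfolding dist_norm[symmetric] by (metis metric_CauchyD)
    \<comment> \<open>On finitely many coordinates the limit in \<open>m\<close> may be taken inside
      the sum; the bound is uniform in \<open>k\<close>, so the full series inherits it.\<close>
    have fin: "(\<Sum>i<k. (norm (entry (X n) i - l i))\<^sup>2) \<le> e\<^sup>2" if "n \<ge> N" for n k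
    proof (rule LIMSEQ_le_const2)
      show "(\<lambda>m. \<Sum>i<k. (norm (entry (X n) i - entry (X m) i))\<^sup>2) \<longlonglongrightarrow>
          (\<Sum>i<k. (norm (entry (X n) i - l i))\<^sup>2)"
        by (intro tendsto_intros l)
      have "(\<Sum>i<k. (norm (entry (X n) i - entry (X m) i))\<^sup>2) \<le> e\<^sup>2" if "m \<ge> N" for m
      proof -
        have "(\<Sum>i<k. (norm (entry (X n - X m) i))\<^sup>2) \<le> (norm (X n - X m))\<^sup>2"
          unfolding norm_ell2_squared by (rule sum_le_suminf[OF summable_entry]) auto
        also have "\<dots> \<le> e\<^sup>2"
          using N[OF \<open>n \<ge> N\<close> that] by (intro power_mono) auto
        finally show ?thesis by simp
      qed
      then show "\<exists>N. \<forall>m\<ge>N. (\<Sum>i<k. (norm (entry (X n) i - entry (X m) i))\<^sup>2) \<le> e\<^sup>2"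
        by blast
    qed
    have "summable (\<lambda>i. (norm (entry (X n) i - l i))\<^sup>2) \<and>
      suminf (\<lambda>i. (norm (entry (X n) i - l i))\<^sup>2) \<le> e\<^sup>2" if "n \<ge> N" for n
    proof
      show "summable (\<lambda>i. (norm (entry (X n) i - l i))\<^sup>2)"
        by (rule summableI_nonneg_bounded[of _ "e\<^sup>2"]) (use fin[OF that] in auto)
      then show "suminf (\<lambda>i. (norm (entry (X n) i - l i))\<^sup>2) \<le> e\<^sup>2"
        by (rule suminf_le_const) (rule fin[OF that])
    qed
    then show ?thesis by blast
  qed
  obtain n where n: "summable (\<lambda>i. (norm (entry (X n) i - l i))\<^sup>2)"
    using tail[of 1] by auto
  \<comment> \<open>The coordinatewise limit is square-summable as the sum of this difference and
    \<open>X n\<close>.\<close>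
  then have "summable (\<lambda>i. (norm (l i - entry (X n) i))\<^sup>2)"
    by (simp add: norm_minus_commute)
  from square_summable_add(1)[OF this summable_entry[of "X n"]]
  have "summable (\<lambda>i. (norm (l i))\<^sup>2)" by simp
  then have el: "entry (Abs_ell2 l) = l"
    by (rule entry_Abs_ell2)
  have "X \<longlonglongrightarrow> Abs_ell2 l"
  proof (rule metric_LIMSEQ_I)
    fix r :: real assume "0 < r"
    then obtain N where N: "\<forall>n\<ge>N. suminf (\<lambda>i. (norm (entry (X n) i - l i))\<^sup>2) \<le> (r / 2)\<^sup>2"
      using tail[of "r / 2"] by auto
    have "dist (X n) (Abs_ell2 l) < r" if "n \<ge> N" for n
    proof -
      have "(norm (X n - Abs_ell2 l))\<^sup>2 \<le> (r / 2)\<^sup>2"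
        using N that by (simp add: norm_ell2_squared el)
      then have "norm (X n - Abs_ell2 l) \<le> r / 2"
        by (rule power2_le_imp_le) (use \<open>0 < r\<close> in simp)
      then show ?thesis
        using \<open>0 < r\<close> by (simp add: dist_norm)
    qed
    then show "\<exists>N. \<forall>n\<ge>N. dist (X n) (Abs_ell2 l) < r" by blast
  qed
  then show "convergent X" by (rule convergentI)
qed

instantiation ell2 :: (chilbert_space) chilbert_space
begin

definition "scaleC_ell2 c x = Abs_ell2 (\<lambda>i. c *\<^sub>C entry x i :: 'a)"
definition "cinner_ell2 (x :: 'a ell2) y = suminf (\<lambda>i. cinner (entry x i) (entry y i))"

lemma entry_scaleC [simp]: "entry (c *\<^sub>C x :: 'a ell2) i = c *\<^sub>C entry x i"
  by (simp add: scaleC_ell2_def entry_Abs_ell2 square_summable_scaleC summable_entry)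

instance
proof
  fix x y z :: "'a ell2" and c d :: complex and r :: real
  have sm: "summable (\<lambda>i. cinner (entry x i) (entry y i))" for x y :: "'a ell2"
    by (rule summable_cinner) (rule summable_entry)+
  show "c *\<^sub>C (x + y) = c *\<^sub>C x + c *\<^sub>C y" "(c + d) *\<^sub>C x = c *\<^sub>C x + d *\<^sub>C x"
    "c *\<^sub>C d *\<^sub>C x = (c * d) *\<^sub>C x" "complex_of_real r *\<^sub>C x = r *\<^sub>R x"
    by (rule ell2_eqI; simp add: scaleC_add_right scaleC_add_left scaleC_scaleC scaleC_of_real)+
  have "cinner x y = suminf (\<lambda>i. cnj (cinner (entry y i) (entry x i)))"
    unfolding cinner_ell2_def by (metis cinner_commute)
  also have "\<dots> = cnj (cinner y x)"
    unfolding cinner_ell2_def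
    by (rule sums_unique[symmetric]) (use summable_sums[OF sm] in \<open>simp add: sums_cnj\<close>)
  finally show "cinner x y = cnj (cinner y x)" .
  show "cinner (x + y) z = cinner x z + cinner y z"
    by (simp add: cinner_ell2_def cinner_add_left suminf_add sm)
  show "cinner (c *\<^sub>C x) y = c * cinner x y"
    by (simp add: cinner_ell2_def cinner_scaleC_left suminf_mult sm)
  show "norm x = sqrt (Re (cinner x x))"
    by (simp add: cinner_ell2_def norm_ell2_def Re_suminf sm Re_cinner_self)
qed

end

section \<open>Coordinate embeddings and diagonal operators\<close>

definition unit_at :: "nat \<Rightarrow> 'a::chilbert_space \<Rightarrow> 'a ell2" where
  "unit_at j v = Abs_ell2 (\<lambda>i. if i = j then v else 0)"

lemma entry_unit_at: "entry (unit_at j v) i = (if i = j then v else 0)"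
proof -
  have "summable (\<lambda>i. (norm (if i = j then v else 0))\<^sup>2)"
    by (rule summable_finite[of "{j}"]) auto
  then show ?thesis
    by (simp add: unit_at_def entry_Abs_ell2)
qed

text \<open>The embedding \<open>unit_at j\<close> is the adjoint of taking the entry at
  \<open>j\<close>; this gives access to the matrix entries of operators on
  \<open>ell2\<close>.\<close>

lemma cinner_unit_at: "cinner x (unit_at j v) = cinner (entry x j) v"
proof -
  have "cinner x (unit_at j v) = (\<Sum>i\<in>{j}. cinner (entry x i) (entry (unit_at j v) i))"
    unfolding cinner_ell2_def by (rule suminf_finite) (auto simp: entry_unit_at)
  then show ?thesis
    by (simp add: entry_unit_at)
qed

lemma norm_unit_at: "norm (unit_at j v) = norm v"
proof -
  have "(norm (unit_at j v))\<^sup>2 = (norm v)\<^sup>2"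
    by (simp add: Re_cinner_self[symmetric] cinner_unit_at entry_unit_at)
  then show ?thesis by (simp add: power2_eq_iff_nonneg)
qed

text \<open>The diagonal operator with \<open>a\<close> in every coordinate. \<open>Abs_ell2\<close>
  is meaningful here once the image is square-summable, which boundedness of \<open>a\<close>
  ensures.\<close>

definition amplification :: "('a::chilbert_space \<Rightarrow> 'a) \<Rightarrow> 'a ell2 \<Rightarrow> 'a ell2" where
  "amplification a x = Abs_ell2 (\<lambda>i. a (entry x i))"

lemma square_summable_bounded_clinear:
  assumes a: "bounded_clinear a" and z: "summable (\<lambda>i. (norm (z i))\<^sup>2)"
  shows "summable (\<lambda>i. (norm (a (z i)))\<^sup>2)"
proof -
  obtain K where K: "\<And>v. norm (a v) \<le> norm v * K"
    using a bounded_linear.bounded[of a] by (auto simp: bounded_clinear_def)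
  have le: "norm ((norm (a (z i)))\<^sup>2) \<le> (norm (z i))\<^sup>2 * K\<^sup>2" for i
    using power_mono[OF K[of "z i"], of 2] by (simp add: power_mult_distrib)
  show ?thesis
    by (rule summable_comparison_test'[OF summable_mult2[OF z, of "K\<^sup>2"], of 0]) (rule le)
qed

lemma entry_amplification:
  assumes "bounded_clinear a"
  shows "entry (amplification a x) i = a (entry x i)"
  by (simp add: amplification_def entry_Abs_ell2
      square_summable_bounded_clinear[OF assms] summable_entry)

lemma amplification_unit_at:
  "bounded_clinear a \<Longrightarrow> amplification a (unit_at j v) = unit_at j (a v)"
  by (rule ell2_eqI) (simp add: entry_amplification entry_unit_at bounded_clinear_zero)

lemma bounded_clinear_amplification:
  assumes a: "bounded_clinear a"
  shows "bounded_clinear (amplification a)"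
proof -
  obtain K where K: "\<And>v. norm (a v) \<le> norm v * K" "0 \<le> K"
    using a bounded_linear.nonneg_bounded[of a] by (auto simp: bounded_clinear_def)
  show ?thesis
  proof (rule bounded_clinear_intro)
    fix x
    have "(norm (amplification a x))\<^sup>2 \<le> suminf (\<lambda>i. (norm (entry x i))\<^sup>2 * K\<^sup>2)"
      unfolding norm_ell2_squared
    proof (rule suminf_le)
      show "(norm (entry (amplification a x) i))\<^sup>2 \<le> (norm (entry x i))\<^sup>2 * K\<^sup>2" for i
        using power_mono[OF K(1)[of "entry x i"], of 2]
        by (simp add: power_mult_distrib entry_amplification[OF a])
    qed (intro summable_mult2 summable_entry)+
    also have "\<dots> = (norm x * K)\<^sup>2"
      by (simp add: suminf_mult2[OF summable_entry, symmetric] norm_ell2_squared power_mult_distrib)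
    finally show "norm (amplification a x) \<le> norm x * K"
      by (rule power2_le_imp_le) (use K in simp)
  qed (auto intro!: ell2_eqI simp: entry_amplification[OF a]
      bounded_clinear_add[OF a] bounded_clinear_scaleC[OF a])
qed

section \<open>Commutants\<close>

lemma commutant_bounded: "b \<in> commutant S \<Longrightarrow> bounded_clinear b"
  by (simp add: commutant_def)

lemma commutant_apply: "b \<in> commutant S \<Longrightarrow> a \<in> S \<Longrightarrow> a (b x) = b (a x)"
  by (auto simp: commutant_def fun_eq_iff)

lemma commutantI:
  "bounded_clinear b \<Longrightarrow> (\<And>a x. a \<in> S \<Longrightarrow> a (b x) = b (a x)) \<Longrightarrow> b \<in> commutant S"
  by (auto simp: commutant_def fun_eq_iff)

lemma commutant_comp:
  assumes "a \<in> commutant S" "b \<in> commutant S"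
  shows "a \<circ> b \<in> commutant S"
proof (rule commutantI)
  show "s ((a \<circ> b) x) = (a \<circ> b) (s x)" if "s \<in> S" for s x
    using assms that by (metis commutant_apply comp_apply)
qed (use assms in \<open>auto intro: bounded_clinear_comp commutant_bounded\<close>)

lemma commutant_id: "id \<in> commutant S"
  by (rule commutantI) (auto simp: bounded_clinear_id)

lemma commutant_zero:
  "(\<And>s. s \<in> S \<Longrightarrow> bounded_clinear s) \<Longrightarrow> (\<lambda>x. 0) \<in> commutant S"
  by (rule commutantI) (auto simp: bounded_clinear_0 bounded_clinear_zero)

lemma commutant_add:
  assumes S: "\<And>s. s \<in> S \<Longrightarrow> bounded_clinear s" and a: "a \<in> commutant S" and b: "b \<in> commutant S"
  shows "(\<lambda>x. a x + b x) \<in> commutant S"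
proof (rule commutantI)
  show "s (a x + b x) = a (s x) + b (s x)" if "s \<in> S" for s x
    by (simp add: bounded_clinear_add[OF S[OF that]] commutant_apply[OF a that]
        commutant_apply[OF b that])
qed (use a b in \<open>auto intro: bounded_clinear_add_fun commutant_bounded\<close>)

lemma commutant_scale:
  assumes S: "\<And>s. s \<in> S \<Longrightarrow> bounded_clinear s" and a: "a \<in> commutant S"
  shows "(\<lambda>x. c *\<^sub>C a x) \<in> commutant S"
proof (rule commutantI)
  show "s (c *\<^sub>C a x) = c *\<^sub>C a (s x)" if "s \<in> S" for s x
    by (simp add: bounded_clinear_scaleC[OF S[OF that]] commutant_apply[OF a that])
qed (use a in \<open>auto intro: bounded_clinear_scaleC_fun commutant_bounded\<close>)

text \<open>Taking adjoints in the relation between \<open>b\<close> and \<open>cadj a\<close> gives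
  the relation between \<open>cadj b\<close> and \<open>a\<close>, so \<open>S\<close> has to be
  closed under adjoints.\<close>

lemma commutant_cadj:
  assumes S: "\<And>s. s \<in> S \<Longrightarrow> bounded_clinear s" "\<And>s. s \<in> S \<Longrightarrow> cadj s \<in> S"
    and b: "b \<in> commutant S"
  shows "cadj b \<in> commutant S"
proof (rule commutantI)
  have bb: "bounded_clinear b"
    using b by (rule commutant_bounded)
  then show "bounded_clinear (cadj b)"
    by (rule bounded_clinear_cadj)
  fix a x assume a: "a \<in> S"
  show "a (cadj b x) = cadj b (a x)"
  proof (rule cinner_eqI)
    fix y
    show "cinner (a (cadj b x)) y = cinner (cadj b (a x)) y"
      using commutant_apply[OF b S(2)[OF a]]
      by (simp add: cinner_cadj[OF S(1)[OF a]] cinner_cadj'[OF bb, symmetric])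
  qed
qed

lemma subset_bicommutant:
  assumes "\<And>s. s \<in> S \<Longrightarrow> bounded_clinear s"
  shows "S \<subseteq> commutant (commutant S)"
proof
  fix s assume s: "s \<in> S"
  show "s \<in> commutant (commutant S)"
    by (rule commutantI) (simp_all add: assms s commutant_apply[OF _ s])
qed

text \<open>Commutants reverse the inclusion of \<open>S\<close> in its bicommutant, which gives one
  direction; the other is that inclusion for \<open>commutant S\<close>.\<close>

lemma commutant_commutant_commutant:
  assumes "\<And>s. s \<in> S \<Longrightarrow> bounded_clinear s"
  shows "commutant (commutant (commutant S)) = commutant S"
proof
  show "commutant (commutant (commutant S)) \<subseteq> commutant S"
    using subset_bicommutant[OF assms]
    by (blast intro: commutantI commutant_bounded commutant_apply)
  show "commutant S \<subseteq> commutant (commutant (commutant S))"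
    by (rule subset_bicommutant) (rule commutant_bounded)
qed

text \<open>The bicommutant is one of the von Neumann algebras intersected in
  \<open>vn_generated\<close>. This brings elements of the generated algebra within reach of the
  density theorem.\<close>

lemma vn_generated_subset_bicommutant:
  assumes S: "\<And>s. s \<in> S \<Longrightarrow> bounded_clinear s" "\<And>s. s \<in> S \<Longrightarrow> cadj s \<in> S"
  shows "vn_generated S \<subseteq> commutant (commutant S)"
proof -
  have "von_neumann_algebra (commutant (commutant S))"
    unfolding von_neumann_algebra_def
  proof (intro conjI ballI)
    show "cadj a \<in> commutant (commutant S)" if "a \<in> commutant (commutant S)" for a
      using that by (rule commutant_cadj[rotated 2]) (simp_all add: commutant_bounded commutant_cadj[OF S])
  qed (simp_all add: commutant_commutant_commutant commutant_bounded)
  moreover have "S \<subseteq> commutant (commutant S)"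
    using S(1) by (rule subset_bicommutant)
  ultimately show ?thesis
    by (auto simp: vn_generated_def)
qed

section \<open>Non-commutative polynomials\<close>

text \<open>The common linear extension from words to polynomials behind \<open>nc_eval\<close> and
  \<open>nc_deriv\<close>, so that linearity is proved once for both.\<close>

definition word_sum :: "('n list \<Rightarrow> 'h::chilbert_space) \<Rightarrow> 'n ncpoly \<Rightarrow> 'h" where
  "word_sum f p = (\<Sum>w\<in>Poly_Mapping.keys p. Poly_Mapping.lookup p w *\<^sub>C f w)"

lemma nc_eval_word_sum: "nc_eval A p \<zeta> = word_sum (\<lambda>w. nc_monom A w \<zeta>) p"
  by (simp add: nc_eval_def word_sum_def)

lemma nc_deriv_word_sum: "nc_deriv A T p \<zeta> = word_sum (\<lambda>w. nc_deriv_monom A T w \<zeta>) p"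
  by (simp add: nc_deriv_def word_sum_def)

lemma nc_vectors_word_sum: "nc_vectors A \<Omega> = range (word_sum (\<lambda>w. nc_monom A w \<Omega>))"
  by (simp add: nc_vectors_def nc_eval_word_sum)

lemma word_sum_superset:
  assumes "finite W" "Poly_Mapping.keys p \<subseteq> W"
  shows "word_sum f p = (\<Sum>w\<in>W. Poly_Mapping.lookup p w *\<^sub>C f w)"
  unfolding word_sum_def using assms by (intro sum.mono_neutral_left) (auto simp: in_keys_iff)

lemma word_sum_zero [simp]: "word_sum f 0 = 0"
  by (simp add: word_sum_def)

lemma word_sum_add: "word_sum f (p + q) = word_sum f p + word_sum f q"
proof -
  define W where "W = Poly_Mapping.keys p \<union> Poly_Mapping.keys q"
  have W: "finite W" "Poly_Mapping.keys p \<subseteq> W" "Poly_Mapping.keys q \<subseteq> W"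
    "Poly_Mapping.keys (p + q) \<subseteq> W"
    using keys_add[of p q] by (auto simp: W_def)
  show ?thesis
    using W by (simp add: word_sum_superset[where W = W] lookup_add scaleC_add_left sum.distrib)
qed

lemma word_sum_sum: "word_sum f (\<Sum>i\<in>I. p i) = (\<Sum>i\<in>I. word_sum f (p i))"
  by (induction I rule: infinite_finite_induct) (auto simp: word_sum_add)

lemma word_sum_single: "word_sum f (Poly_Mapping.single w c) = c *\<^sub>C f w"
  by (simp add: word_sum_superset[where W = "{w}"])

text \<open>Used with the identity on words for multiplication by \<open>c\<close>, and with
  \<open>Cons j\<close> for left multiplication by a variable. Words with the same image have their
  coefficients added.\<close>

definition map_words :: "('n list \<Rightarrow> 'n list) \<Rightarrow> complex \<Rightarrow> 'n ncpoly \<Rightarrow> 'n ncpoly" where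
  "map_words h c p =
    (\<Sum>w\<in>Poly_Mapping.keys p. Poly_Mapping.single (h w) (c * Poly_Mapping.lookup p w))"

lemma word_sum_map_words: "word_sum f (map_words h c p) = c *\<^sub>C word_sum (\<lambda>w. f (h w)) p"
  unfolding map_words_def word_sum_sum word_sum_single
  by (simp add: word_sum_def scaleC_scaleC complex_vector.scale_sum_right)

lemma word_sum_bounded_clinear: "bounded_clinear a \<Longrightarrow> a (word_sum f p) = word_sum (\<lambda>w. a (f w)) p"
  by (simp add: word_sum_def bounded_clinear_sum bounded_clinear_scaleC)

lemma word_sum_distrib: "word_sum (\<lambda>w. f w + g w) p = word_sum f p + word_sum g p"
  by (simp add: word_sum_def scaleC_add_right sum.distrib)

lemma cinner_word_sum_left: "cinner (word_sum f p) x =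
    (\<Sum>w\<in>Poly_Mapping.keys p. Poly_Mapping.lookup p w * cinner (f w) x)"
  by (simp add: word_sum_def cinner_sum_left cinner_scaleC_left)

lemma cinner_word_sum_right: "cinner x (word_sum f p) =
    (\<Sum>w\<in>Poly_Mapping.keys p. cnj (Poly_Mapping.lookup p w) * cinner x (f w))"
  by (simp add: word_sum_def cinner_sum_right cinner_scaleC_right)

lemma subspace_range_word_sum: "complex_vector.subspace (range (word_sum f))"
proof (rule complex_vector.subspaceI)
  show "0 \<in> range (word_sum f)"
    by (rule range_eqI[of _ _ 0]) simp
  show "x + y \<in> range (word_sum f)" if "x \<in> range (word_sum f)" "y \<in> range (word_sum f)" for x y
    using that by (auto simp: word_sum_add[symmetric])
  show "c *\<^sub>C x \<in> range (word_sum f)" if "x \<in> range (word_sum f)" for c x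
    using that by (auto simp: word_sum_map_words[of f "\<lambda>w. w" c, symmetric])
qed

lemma nc_monom_Nil [simp]: "nc_monom A [] = id"
  by (simp add: nc_monom_def)

lemma nc_monom_Cons [simp]: "nc_monom A (j # w) = A j \<circ> nc_monom A w"
  by (simp add: nc_monom_def)

lemma nc_monom_append: "nc_monom A (u @ v) = nc_monom A u \<circ> nc_monom A v"
  by (simp add: nc_monom_def fun_eq_iff)

lemma bounded_clinear_nc_monom:
  "(\<And>j. bounded_clinear (A j)) \<Longrightarrow> bounded_clinear (nc_monom A w)"
  by (induction w) (auto intro: bounded_clinear_comp simp: bounded_clinear_id)

lemma nc_monom_in_nc_vectors: "nc_monom A w \<Omega> \<in> nc_vectors A \<Omega>"
  unfolding nc_vectors_word_sum by (rule range_eqI[of _ _ "Poly_Mapping.single w 1"])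
    (simp add: word_sum_single)

lemma nc_vectors_invariant:
  assumes "bounded_clinear (A j)" "\<zeta> \<in> nc_vectors A \<Omega>"
  shows "A j \<zeta> \<in> nc_vectors A \<Omega>"
proof -
  obtain p where "\<zeta> = word_sum (\<lambda>w. nc_monom A w \<Omega>) p"
    using assms(2) by (auto simp: nc_vectors_word_sum)
  then have "A j \<zeta> = word_sum (\<lambda>w. nc_monom A w \<Omega>) (map_words (Cons j) 1 p)"
    by (simp add: word_sum_map_words word_sum_bounded_clinear[OF assms(1)])
  then show ?thesis
    by (simp add: nc_vectors_word_sum)
qed

section \<open>Von Neumann's density theorem\<close>

lemma cinner_amplification:
  assumes "bounded_clinear a"
  shows "cinner (amplification a x) y = cinner x (amplification (cadj a) y)"
  by (simp add: cinner_ell2_def entry_amplification assms bounded_clinear_cadj cinner_cadj)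

lemma entry_sum: "entry (sum f I) i = (\<Sum>w\<in>I. entry (f w) i)"
  by (induction I rule: infinite_finite_induct) auto

lemma entry_nc_eval:
  assumes "\<And>j. bounded_clinear (X j)"
  shows "entry (nc_eval (\<lambda>j. amplification (X j)) p x) i = nc_eval X p (entry x i)"
proof -
  have "entry (nc_monom (\<lambda>j. amplification (X j)) w x) i = nc_monom X w (entry x i)" for w
    by (induction w) (auto simp: entry_amplification assms)
  then show ?thesis
    by (simp add: nc_eval_def entry_sum)
qed

text \<open>Von Neumann's density argument: the projection onto the closure of the polynomial orbit of
  \<open>x\<close> commutes with the amplified \<open>X j\<close>, so its matrix entries lie in the commutant and commute
  with \<open>a\<close>.\<close>

lemma amplification_in_closure:
  assumes X: "\<And>j. bounded_clinear (X j)" "\<And>j. cadj (X j) = X j"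
    and a: "a \<in> commutant (commutant (range X))"
  shows "amplification a x \<in> closure (nc_vectors (\<lambda>j. amplification (X j)) x)"
proof -
  define E where "E = closure (nc_vectors (\<lambda>j. amplification (X j)) x)"
  define P where "P = orth_proj E"
  have E: "complex_vector.subspace E" "closed E"
    by (simp_all add: E_def nc_vectors_word_sum subspace_closure subspace_range_word_sum)
  \<comment> \<open>The empty word puts \<open>x\<close> itself into its orbit.\<close>
  have xE: "x \<in> E"
    using nc_monom_in_nc_vectors[of _ "[]" x] closure_subset by (fastforce simp: E_def)
  have aX: "bounded_clinear (amplification (X j))" for j
    by (rule bounded_clinear_amplification[OF X(1)])
  have "amplification (X j) ` E \<subseteq> E" for j
    unfolding E_def
  proof (rule image_closure_subset)
    show "continuous_on (closure (nc_vectors (\<lambda>j. amplification (X j)) x)) (amplification (X j))"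
      using aX[of j] by (simp add: bounded_clinear_def linear_continuous_on)
    show "amplification (X j) ` nc_vectors (\<lambda>j. amplification (X j)) x
        \<subseteq> closure (nc_vectors (\<lambda>j. amplification (X j)) x)"
      using nc_vectors_invariant[of "\<lambda>j. amplification (X j)", OF aX] closure_subset by blast
  qed simp
  then have inv: "amplification (X j) y \<in> E" if "y \<in> E" for j y
    using that by blast
  \<comment> \<open>Self-adjointness makes the invariant subspace \<open>E\<close> reducing, which
    is what \<open>orth_proj_commute\<close> requires.\<close>
  have "cadj (amplification (X j)) = amplification (X j)" for j
    by (rule cadj_eqI) (simp add: cinner_amplification X)
  then have PX: "P (amplification (X j) y) = amplification (X j) (P y)" for j y
    unfolding P_def using inv by (intro orth_proj_commute[OF E aX]) auto
  have P: "bounded_clinear P"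
    unfolding P_def by (rule bounded_clinear_orth_proj[OF E])
  obtain K where K: "\<And>v. norm (P v) \<le> norm v * K"
    using P bounded_linear.bounded[of P] by (auto simp: bounded_clinear_def)
  \<comment> \<open>The matrix entry of \<open>P\<close> in row \<open>i\<close> and column
    \<open>j\<close>.\<close>
  define Q where "Q i j v = entry (P (unit_at j v)) i" for i j v
  have "Q i j \<in> commutant (range X)" for i j
  proof (rule commutantI)
    have add: "unit_at j (v + w) = unit_at j v + unit_at j w" for v w
      by (rule ell2_eqI) (simp add: entry_unit_at)
    have scale: "unit_at j (c *\<^sub>C v) = c *\<^sub>C unit_at j v" for c v
      by (rule ell2_eqI) (simp add: entry_unit_at)
    show "bounded_clinear (Q i j)"
    proof (rule bounded_clinear_intro)
      show "norm (Q i j v) \<le> norm v * K" for v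
        using norm_entry_le[of "P (unit_at j v)" i] K[of "unit_at j v"]
        by (simp add: Q_def norm_unit_at)
    qed (simp_all add: Q_def add scale bounded_clinear_add[OF P] bounded_clinear_scaleC[OF P])
    fix b v assume "b \<in> range X"
    then obtain k where b: "b = X k" by blast
    show "b (Q i j v) = Q i j (b v)"
      by (simp add: b Q_def PX entry_amplification X amplification_unit_at[symmetric])
  qed
  moreover have ba: "bounded_clinear a"
    by (rule commutant_bounded[OF a])
  \<comment> \<open>The computation of \<open>Pa\<close> moves \<open>a\<close> across the inner
    product, so it is the adjoint that has to commute with the matrix entries.\<close>
  moreover have "cadj a \<in> commutant (commutant (range X))"
    using a X by (intro commutant_cadj) (auto intro: commutant_bounded commutant_cadj)
  ultimately have Qa: "cadj a (Q i j v) = Q i j (cadj a v)" for i j v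
    by (metis commutant_apply)
  \<comment> \<open>Self-adjointness of \<open>P\<close> moves it onto a coordinate vector, so only
    one column of its matrix occurs and no infinite matrix product is expanded.\<close>
  have Pa: "cinner (entry (P (amplification a x)) i) v = cinner (a (entry x i)) v" for i v
  proof -
    have "cinner (entry (P (amplification a x)) i) v =
        cinner (amplification a x) (P (unit_at i v))"
      by (simp add: cinner_unit_at[symmetric] P_def cinner_orth_proj[OF E])
    also have "\<dots> = cinner x (amplification (cadj a) (P (unit_at i v)))"
      by (rule cinner_amplification[OF ba])
    also have "amplification (cadj a) (P (unit_at i v)) = P (unit_at i (cadj a v))"
      by (rule ell2_eqI)
        (use Qa in \<open>simp add: Q_def entry_amplification bounded_clinear_cadj[OF ba]\<close>)
    also have "cinner x \<dots> = cinner (P x) (unit_at i (cadj a v))"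
      by (simp add: P_def cinner_orth_proj[OF E])
    also have "P x = x"
      unfolding P_def by (rule orth_proj_eqI[OF E(1) xE]) simp
    finally show ?thesis
      by (simp add: cinner_unit_at cinner_cadj[OF ba])
  qed
  have "P (amplification a x) = amplification a x"
    by (rule ell2_eqI, rule cinner_eqI) (simp add: entry_amplification[OF ba] Pa)
  moreover have "P (amplification a x) \<in> E"
    unfolding P_def by (rule orth_proj_closed[OF E])
  ultimately show ?thesis
    by (simp add: E_def)
qed

text \<open>The orbit closure statement is applied to the single \<open>ell2\<close> vector given by
  \<open>z\<close>; the squared distance there is the series to be made small.\<close>

lemma bicommutant_approximation:
  fixes X :: "'n \<Rightarrow> 'k::chilbert_space \<Rightarrow> 'k"
  assumes X: "\<And>j. bounded_clinear (X j)" "\<And>j. cadj (X j) = X j"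
    and a: "a \<in> commutant (commutant (range X))"
    and z: "summable (\<lambda>i. (norm (z i))\<^sup>2)" and \<epsilon>: "0 < \<epsilon>"
  shows "\<exists>p. suminf (\<lambda>i. (norm (a (z i) - nc_eval X p (z i)))\<^sup>2) < \<epsilon>"
proof -
  have ba: "bounded_clinear a"
    by (rule commutant_bounded[OF a])
  have "amplification a (Abs_ell2 z) \<in>
      closure (nc_vectors (\<lambda>j. amplification (X j)) (Abs_ell2 z))"
    by (rule amplification_in_closure[OF X a])
  moreover have "0 < sqrt \<epsilon>"
    using \<epsilon> by simp
  ultimately obtain y where y: "y \<in> nc_vectors (\<lambda>j. amplification (X j)) (Abs_ell2 z)"
    and d: "dist y (amplification a (Abs_ell2 z)) < sqrt \<epsilon>"
    unfolding closure_approachable by blast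
  from y obtain p where p: "y = nc_eval (\<lambda>j. amplification (X j)) p (Abs_ell2 z)"
    by (auto simp: nc_vectors_def)
  have "(norm (amplification a (Abs_ell2 z) - y))\<^sup>2 < (sqrt \<epsilon>)\<^sup>2"
    using d by (intro power_strict_mono) (auto simp: dist_norm norm_minus_commute)
  then have "suminf (\<lambda>i. (norm (a (z i) - nc_eval X p (z i)))\<^sup>2) < \<epsilon>"
    using \<epsilon> by (simp add: norm_ell2_squared p entry_nc_eval X entry_amplification[OF ba]
        entry_Abs_ell2[OF z])
  then show ?thesis by blast
qed

section \<open>Normality of the trace\<close>

text \<open>The terms of \<open>y\<close> occupy the even positions and those of \<open>x\<close>
  the odd ones, the form in which \<open>sums_if\<close> adds two series.\<close>

lemma sums_interleave:
  assumes x: "summable (\<lambda>i. (norm (x i))\<^sup>2)" and y: "summable (\<lambda>i. (norm (y i))\<^sup>2)"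
  defines "z \<equiv> (\<lambda>i. if even i then y (i div 2) else x ((i - 1) div 2))"
  shows "(\<lambda>i. (norm (z i))\<^sup>2) sums
    (suminf (\<lambda>i. (norm (x i))\<^sup>2) + suminf (\<lambda>i. (norm (y i))\<^sup>2))"
proof -
  have "(norm (z i))\<^sup>2 =
      (if even i then (norm (y (i div 2)))\<^sup>2 else (norm (x ((i - 1) div 2)))\<^sup>2)" for i
    by (simp add: z_def)
  then show ?thesis
    using sums_if[OF summable_sums[OF x] summable_sums[OF y]] by simp
qed

text \<open>This merges the finitely many constraints of a basic ultraweak neighbourhood into one.\<close>

lemma common_square_summable:
  fixes x y :: "nat \<Rightarrow> 'a::chilbert_space"
  assumes x: "summable (\<lambda>i. (norm (x i))\<^sup>2)" and y: "summable (\<lambda>i. (norm (y i))\<^sup>2)"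
  shows "\<exists>z. summable (\<lambda>i. (norm (z i))\<^sup>2) \<and> (\<forall>b. bounded_clinear b \<longrightarrow>
    suminf (\<lambda>i. (norm (b (z i)))\<^sup>2) =
      suminf (\<lambda>i. (norm (b (x i)))\<^sup>2) + suminf (\<lambda>i. (norm (b (y i)))\<^sup>2))"
proof (intro exI conjI allI impI)
  let ?z = "\<lambda>i. if even i then y (i div 2) else x ((i - 1) div 2)"
  show "summable (\<lambda>i. (norm (?z i))\<^sup>2)"
    by (rule sums_summable[OF sums_interleave[OF x y]])
  fix b :: "'a \<Rightarrow> 'a" assume b: "bounded_clinear b"
  have "b (?z i) = (if even i then b (y (i div 2)) else b (x ((i - 1) div 2)))" for i
    by simp
  then show "suminf (\<lambda>i. (norm (b (?z i)))\<^sup>2) =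
      suminf (\<lambda>i. (norm (b (x i)))\<^sup>2) + suminf (\<lambda>i. (norm (b (y i)))\<^sup>2)"
    using sums_unique[OF sums_interleave[OF square_summable_bounded_clinear[OF b x]
          square_summable_bounded_clinear[OF b y]]]
    by simp
qed

text \<open>Induction over the generation of the topology. A subbasic functional at
  \<open>cadj b \<circ> b\<close> pairs \<open>b (x i)\<close> with \<open>b (y i)\<close> and is
  controlled by square sums; intersections merge two sequences into one, and a union inherits the
  sequence of a member containing zero.\<close>

lemma ultraweak_neighbourhood_zero:
  fixes V :: "('a::chilbert_space \<Rightarrow> 'a) set"
  assumes "openin ultraweak_topology V" and "(\<lambda>x. 0) \<in> V"
  shows "\<exists>z. summable (\<lambda>i::nat. (norm (z i))\<^sup>2) \<and> (\<forall>b. bounded_clinear b \<longrightarrow>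
    suminf (\<lambda>i. (norm (b (z i)))\<^sup>2) < 1 \<longrightarrow> cadj b \<circ> b \<in> V)"
  using assms unfolding ultraweak_topology_def openin_topology_generated_by_iff
proof (induction rule: generate_topology_on.induct)
  case (Int V W)
  obtain x where x: "summable (\<lambda>i::nat. (norm (x i))\<^sup>2)" "\<And>b. bounded_clinear b \<Longrightarrow>
      suminf (\<lambda>i. (norm (b (x i)))\<^sup>2) < 1 \<Longrightarrow> cadj b \<circ> b \<in> V"
    using Int.IH(1) Int.prems by blast
  obtain y where y: "summable (\<lambda>i::nat. (norm (y i))\<^sup>2)" "\<And>b. bounded_clinear b \<Longrightarrow>
      suminf (\<lambda>i. (norm (b (y i)))\<^sup>2) < 1 \<Longrightarrow> cadj b \<circ> b \<in> W"
    using Int.IH(2) Int.prems by blast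
  obtain z where z: "summable (\<lambda>i::nat. (norm (z i))\<^sup>2)" "\<And>b. bounded_clinear b \<Longrightarrow>
      suminf (\<lambda>i. (norm (b (z i)))\<^sup>2) =
      suminf (\<lambda>i. (norm (b (x i)))\<^sup>2) + suminf (\<lambda>i. (norm (b (y i)))\<^sup>2)"
    using common_square_summable[OF x(1) y(1)] by blast
  have "cadj b \<circ> b \<in> V \<inter> W"
    if b: "bounded_clinear b" and lt: "suminf (\<lambda>i. (norm (b (z i)))\<^sup>2) < 1" for b
  proof -
    have "0 \<le> suminf (\<lambda>i. (norm (b (x i)))\<^sup>2)" "0 \<le> suminf (\<lambda>i. (norm (b (y i)))\<^sup>2)"
      by (auto intro!: suminf_nonneg square_summable_bounded_clinear[OF b] x(1) y(1))
    with lt z(2)[OF b] x(2)[OF b] y(2)[OF b] show ?thesis by simp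
  qed
  with z(1) show ?case by blast
next
  case (UN K)
  then obtain V where "V \<in> K" "(\<lambda>x. 0) \<in> V" by blast
  with UN.IH[of V] show ?case by blast
next
  case (Basis V)
  then obtain x y U where xs: "summable (\<lambda>i::nat. (norm (x i))\<^sup>2)"
    and ys: "summable (\<lambda>i. (norm (y i))\<^sup>2)" and "open U"
    and V: "V = {a. bounded_clinear a \<and> suminf (\<lambda>i. cinner (a (x i)) (y i)) \<in> U}"
    by blast
  moreover have "0 \<in> U"
    using Basis.prems by (simp add: V)
  ultimately obtain e where e: "0 < e" "ball 0 e \<subseteq> U"
    by (meson open_contains_ball)
  obtain z where z: "summable (\<lambda>i::nat. (norm (z i))\<^sup>2)" "\<And>b. bounded_clinear b \<Longrightarrow>
      suminf (\<lambda>i. (norm (b (z i)))\<^sup>2) =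
      suminf (\<lambda>i. (norm (b (x i)))\<^sup>2) + suminf (\<lambda>i. (norm (b (y i)))\<^sup>2)"
    using common_square_summable[OF xs ys] by blast
  \<comment> \<open>Rescaling \<open>z\<close> turns the threshold \<open>e\<close> given by the
    ball inside \<open>U\<close> into the normalized threshold 1.\<close>
  define s where "s = complex_of_real (1 / sqrt e)"
  have s: "(cmod s)\<^sup>2 = 1 / e"
    unfolding s_def norm_of_real power2_abs using e(1) by (simp add: power_divide)
  have "cadj b \<circ> b \<in> V"
    if b: "bounded_clinear b" and lt: "suminf (\<lambda>i. (norm (b (s *\<^sub>C z i)))\<^sup>2) < 1" for b
  proof -
    have bx: "summable (\<lambda>i. (norm (b (x i)))\<^sup>2)" and by': "summable (\<lambda>i. (norm (b (y i)))\<^sup>2)"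
      and bz: "summable (\<lambda>i. (norm (b (z i)))\<^sup>2)"
      by (rule square_summable_bounded_clinear[OF b]; fact)+
    have "1 / e * suminf (\<lambda>i. (norm (b (z i)))\<^sup>2) < 1"
      using lt by (simp add: bounded_clinear_scaleC[OF b] norm_scaleC power_mult_distrib s
          suminf_mult[OF bz] suminf_divide[OF bz])
    then have "suminf (\<lambda>i. (norm (b (z i)))\<^sup>2) < e"
      using e(1) by (simp add: field_simps)
    moreover have "cmod (suminf (\<lambda>i. cinner (b (x i)) (b (y i)))) \<le>
        suminf (\<lambda>i. (norm (b (x i)))\<^sup>2 + (norm (b (y i)))\<^sup>2)"
      by (rule norm_suminf_le[OF abs_cinner_le summable_add[OF bx by']])
    ultimately have "suminf (\<lambda>i. cinner (b (x i)) (b (y i))) \<in> U"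
      using e(2) z(2)[OF b] by (auto simp: suminf_add[OF bx by', symmetric] subset_iff)
    then show ?thesis
      by (simp add: V b bounded_clinear_comp bounded_clinear_cadj cinner_cadj'[OF b, symmetric])
  qed
  moreover have "summable (\<lambda>i. (norm (s *\<^sub>C z i))\<^sup>2)"
    by (rule square_summable_scaleC[OF z(1)])
  ultimately show ?case
    by (intro exI[of _ "\<lambda>i. s *\<^sub>C z i"] conjI allI impI)
qed simp

text \<open>By normality the elements of \<open>M\<close> with trace in the open unit ball form a
  relatively ultraweakly open set containing zero, to which the neighbourhood lemma applies.\<close>

lemma (in tracial_von_neumann_algebra) trace_square_small:
  "\<exists>z. summable (\<lambda>i::nat. (norm (z i))\<^sup>2) \<and> (\<forall>b\<in>M.
    suminf (\<lambda>i. (norm (b (z i)))\<^sup>2) < 1 \<longrightarrow> cmod (\<tau> (cadj b \<circ> b)) < 1)"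
proof -
  have bounded: "bounded_clinear a" if "a \<in> M" for a
    using that von_neumann by (simp add: von_neumann_algebra_def)
  have M: "commutant (commutant M) = M"
    using von_neumann by (simp add: von_neumann_algebra_def)
  have zM: "(\<lambda>x. 0) \<in> M"
    using commutant_zero[of "commutant M"] commutant_bounded unfolding M by blast
  have t0: "\<tau> (\<lambda>x. 0) = 0"
    using trace_scale[OF zM, of 0] by simp
  have "openin (subtopology ultraweak_topology M)
      {a \<in> topspace (subtopology ultraweak_topology M). \<tau> a \<in> ball 0 1}"
    by (rule openin_continuous_map_preimage[OF trace_normal]) simp
  then obtain V where V: "openin ultraweak_topology V"
    and eq: "{a \<in> topspace (subtopology ultraweak_topology M). \<tau> a \<in> ball 0 1} = V \<inter> M"
    by (auto simp: openin_subtopology)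
  \<comment> \<open>The topological space is the union of the generating sets; zero sequences
    together with \<open>UNIV\<close> give one that contains every bounded operator.\<close>
  have "(\<lambda>x. 0) \<in> topspace (ultraweak_topology :: ('k \<Rightarrow> 'k) topology)"
    unfolding ultraweak_topology_def topology_generated_by_topspace
    by (rule UnionI[of "{a. bounded_clinear a \<and> suminf (\<lambda>i. cinner (a 0) 0) \<in> UNIV}"])
      (auto intro!: exI[of _ "\<lambda>i. 0"] exI[of _ UNIV] simp: bounded_clinear_0)
  then have "(\<lambda>x. 0) \<in> {a \<in> topspace (subtopology ultraweak_topology M). \<tau> a \<in> ball 0 1}"
    using zM t0 by simp
  then have "(\<lambda>x. 0) \<in> V"
    unfolding eq by blast
  from ultraweak_neighbourhood_zero[OF V this] obtain z where
    z: "summable (\<lambda>i::nat. (norm (z i))\<^sup>2)" "\<And>b. bounded_clinear b \<Longrightarrow>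
      suminf (\<lambda>i. (norm (b (z i)))\<^sup>2) < 1 \<Longrightarrow> cadj b \<circ> b \<in> V"
    by blast
  have "cmod (\<tau> (cadj b \<circ> b)) < 1"
    if b: "b \<in> M" and lt: "suminf (\<lambda>i. (norm (b (z i)))\<^sup>2) < 1" for b
  proof -
    have "cadj b \<in> M"
      using von_neumann b by (simp add: von_neumann_algebra_def)
    then have "cadj b \<circ> b \<in> M"
      using b commutant_comp[of "cadj b" "commutant M" b] by (simp add: M)
    then have "cadj b \<circ> b \<in> V \<inter> M"
      using z(2)[OF bounded[OF b] lt] by blast
    then show ?thesis
      unfolding eq[symmetric] by simp
  qed
  with z(1) show ?thesis by blast
qed

section \<open>Density of the polynomial vectors in the GNS space\<close>

text \<open>The density theorem makes \<open>a - p\<close> small on the sequence that controls the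
  trace, and the GNS identity converts smallness of the trace into smallness of the vector.
  Cyclicity then passes from vectors of \<open>M\<close> to the whole space.\<close>

lemma closure_nc_vectors:
  fixes M :: "('k::chilbert_space \<Rightarrow> 'k) set" and \<pi> :: "('k \<Rightarrow> 'k) \<Rightarrow> ('h::chilbert_space \<Rightarrow> 'h)"
    and X :: "'n \<Rightarrow> 'k \<Rightarrow> 'k"
  assumes "tracial_von_neumann_algebra M \<tau>" and "gns_triple M \<tau> \<pi> \<Omega>"
    and X: "\<And>j. X j \<in> M" "\<And>j. cadj (X j) = X j" and gen: "M = vn_generated (range X)"
  shows "closure (nc_vectors (\<lambda>j. \<pi> (X j)) \<Omega>) = UNIV"
proof -
  interpret tracial_von_neumann_algebra M \<tau> by fact
  interpret gns_triple M \<tau> \<pi> \<Omega> by fact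
  have bounded: "bounded_clinear a" if "a \<in> M" for a
    using that von_neumann by (simp add: von_neumann_algebra_def)
  have M: "commutant (commutant M) = M"
    using von_neumann by (simp add: von_neumann_algebra_def)
  have add: "(\<lambda>x. a x + b x) \<in> M" if "a \<in> M" "b \<in> M" for a b
    using commutant_add[of "commutant M" a b, unfolded M] commutant_bounded that by blast
  have scale: "(\<lambda>x. c *\<^sub>C a x) \<in> M" if "a \<in> M" for a c
    using commutant_scale[of "commutant M" a c, unfolded M] commutant_bounded that by blast
  have zero: "(\<lambda>x. 0) \<in> M"
    using commutant_zero[of "commutant M", unfolded M] commutant_bounded by blast
  have comp: "a \<circ> b \<in> M" if "a \<in> M" "b \<in> M" for a b
    using commutant_comp[of a "commutant M" b, unfolded M] that by blast
  have unit: "id \<in> M"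
    using commutant_id[of "commutant M"] by (simp only: M)
  have monom: "nc_monom X w \<in> M \<and> \<pi> (nc_monom X w) = nc_monom (\<lambda>j. \<pi> (X j)) w" for w
  proof (induction w)
    case Nil
    show ?case
      using unit rep_unit by (simp only: nc_monom_Nil simp_thms)
  next
    case (Cons j w)
    then show ?case
      using comp[OF X(1), of "nc_monom X w" j] rep_mult[OF X(1), of "nc_monom X w" j]
      by (simp only: nc_monom_Cons simp_thms)
  qed
  have rep0: "\<pi> (\<lambda>x. 0) = (\<lambda>\<zeta>. 0)"
    using rep_scale[OF zero, of 0] by simp
  have sum: "(\<lambda>x. \<Sum>w\<in>W. c w *\<^sub>C nc_monom X w x) \<in> M \<and>
      \<pi> (\<lambda>x. \<Sum>w\<in>W. c w *\<^sub>C nc_monom X w x) =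
        (\<lambda>\<zeta>. \<Sum>w\<in>W. c w *\<^sub>C nc_monom (\<lambda>j. \<pi> (X j)) w \<zeta>)" for W c
    by (induction W rule: infinite_finite_induct)
      (simp_all add: zero rep0 add scale monom rep_add rep_scale)
  have poly: "nc_eval X p \<in> M" "\<pi> (nc_eval X p) = nc_eval (\<lambda>j. \<pi> (X j)) p" for p
    using sum[of "Poly_Mapping.lookup p" "Poly_Mapping.keys p"]
    by (simp_all add: nc_eval_def[abs_def])
  \<comment> \<open>The GNS identity: the squared norm of the vector of \<open>b\<close> is the
    trace of \<open>cadj b \<circ> b\<close>.\<close>
  have norm_rep: "complex_of_real ((norm (\<pi> b \<Omega>))\<^sup>2) = \<tau> (cadj b \<circ> b)" if b: "b \<in> M" for b
  proof -
    have c: "cadj b \<in> M"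
      using von_neumann b by (simp add: von_neumann_algebra_def)
    have "cinner (\<pi> b \<Omega>) (\<pi> b \<Omega>) = cinner (\<pi> (cadj b \<circ> b) \<Omega>) \<Omega>"
      by (simp add: cinner_cadj'[OF rep_bounded[OF b]] rep_mult[OF c b] rep_adj[OF b])
    then show ?thesis
      by (simp only: cinner_self vector_state[OF comp[OF c b]])
  qed
  obtain z where z: "summable (\<lambda>i::nat. (norm (z i))\<^sup>2)" "\<And>b. b \<in> M \<Longrightarrow>
      suminf (\<lambda>i. (norm (b (z i)))\<^sup>2) < 1 \<Longrightarrow> cmod (\<tau> (cadj b \<circ> b)) < 1"
    using trace_square_small by blast
  have "\<pi> a \<Omega> \<in> closure (nc_vectors (\<lambda>j. \<pi> (X j)) \<Omega>)" if a: "a \<in> M" for a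
    unfolding closure_approachable
  proof (intro allI impI)
    fix e :: real assume e: "0 < e"
    have "a \<in> commutant (commutant (range X))"
      using vn_generated_subset_bicommutant[of "range X"] a gen X bounded by auto
    from bicommutant_approximation[OF bounded[OF X(1)] X(2) this z(1), of "e\<^sup>2"] e
    obtain p where p: "suminf (\<lambda>i. (norm (a (z i) - nc_eval X p (z i)))\<^sup>2) < e\<^sup>2"
      by auto
    \<comment> \<open>The difference is written with the scalar -1 to match the sum and scaling
      axioms of the representation. Dividing \<open>d\<close> by \<open>e\<close> reaches the
      threshold 1 of the trace estimate.\<close>
    define d where "d = (\<lambda>x. a x + (-1) *\<^sub>C nc_eval X p x)"
    define s where "s = complex_of_real (1 / e)"
    define b where "b = (\<lambda>x. s *\<^sub>C d x)"
    have minus: "(-1) *\<^sub>C v = - v" for v :: "'c::chilbert_space"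
      using scaleC_of_real[of "-1" v] by simp
    have d: "d \<in> M" "\<pi> d \<Omega> = \<pi> a \<Omega> - nc_eval (\<lambda>j. \<pi> (X j)) p \<Omega>"
      unfolding d_def rep_add[OF a scale[OF poly(1)]] rep_scale[OF poly(1)] poly(2)
      by (rule add[OF a scale[OF poly(1)]]) (simp add: minus)
    have b: "b \<in> M" "\<pi> b \<Omega> = s *\<^sub>C \<pi> d \<Omega>"
      unfolding b_def rep_scale[OF d(1)] by (rule scale[OF d(1)]) (rule refl)
    have cs: "cmod s = 1 / e"
      using e by (simp add: s_def norm_divide)
    have dz: "summable (\<lambda>i. (norm (d (z i)))\<^sup>2)"
      by (rule square_summable_bounded_clinear[OF bounded[OF d(1)] z(1)])
    have "suminf (\<lambda>i. (norm (b (z i)))\<^sup>2) = (1 / e)\<^sup>2 * suminf (\<lambda>i. (norm (d (z i)))\<^sup>2)"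
      unfolding b_def norm_scaleC cs power_mult_distrib by (rule suminf_mult[OF dz])
    also have "\<dots> < 1"
      using p e by (simp add: d_def minus power_divide field_simps)
    finally have "cmod (complex_of_real ((norm (\<pi> b \<Omega>))\<^sup>2)) < 1"
      unfolding norm_rep[OF b(1)] by (rule z(2)[OF b(1)])
    then have "(norm (\<pi> b \<Omega>))\<^sup>2 < 1"
      by (simp only: norm_of_real abs_power2)
    then have "norm (\<pi> b \<Omega>) < 1"
      using power2_less_imp_less[of "norm (\<pi> b \<Omega>)" 1] by simp
    then have "norm (\<pi> d \<Omega>) < e"
      using e by (simp add: b(2) norm_scaleC cs)
    then have "dist (nc_eval (\<lambda>j. \<pi> (X j)) p \<Omega>) (\<pi> a \<Omega>) < e"
      by (simp add: d(2) dist_norm norm_minus_commute)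
    then show "\<exists>y\<in>nc_vectors (\<lambda>j. \<pi> (X j)) \<Omega>. dist y (\<pi> a \<Omega>) < e"
      by (auto simp: nc_vectors_def)
  qed
  then have "closure ((\<lambda>a. \<pi> a \<Omega>) ` M) \<subseteq> closure (nc_vectors (\<lambda>j. \<pi> (X j)) \<Omega>)"
    by (intro closure_minimal) auto
  then show ?thesis
    unfolding cyclic by blast
qed

section \<open>The derivation and its adjoint\<close>

lemma nc_deriv_monom_Nil [simp]: "nc_deriv_monom A T [] \<zeta> = 0"
  by (simp add: nc_deriv_monom_def)

text \<open>The summand at position 0 differentiates the first letter; all others share the factor
  \<open>A j\<close> on the left.\<close>

lemma nc_deriv_monom_Cons:
  assumes "bounded_clinear (A j)"
  shows "nc_deriv_monom A T (j # w) \<zeta> = T j (nc_monom A w \<zeta>) + A j (nc_deriv_monom A T w \<zeta>)"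
  by (simp add: nc_deriv_monom_def sum.lessThan_Suc_shift bounded_clinear_sum[OF assms]
      del: sum.lessThan_Suc)

text \<open>The Leibniz rule for a product of two words, by induction on the left one.\<close>

lemma nc_deriv_monom_append:
  assumes "\<And>j. bounded_clinear (A j)"
  shows "nc_deriv_monom A T (u @ v) \<zeta> =
    nc_deriv_monom A T u (nc_monom A v \<zeta>) + nc_monom A u (nc_deriv_monom A T v \<zeta>)"
  by (induction u)
    (simp_all add: nc_deriv_monom_Cons assms nc_monom_append bounded_clinear_add)

lemma bounded_clinear_nc_deriv:
  assumes A: "\<And>j. bounded_clinear (A j)" and T: "\<And>j. bounded_clinear (T j)"
  shows "bounded_clinear (nc_deriv_monom A T w)" and "bounded_clinear (nc_deriv A T p)"
proof -
  have "nc_deriv_monom A T w = (\<lambda>\<zeta>. \<Sum>l<length w.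
      (nc_monom A (take l w) \<circ> (T (w ! l) \<circ> nc_monom A (drop (Suc l) w))) \<zeta>)" for w
    by (simp add: fun_eq_iff nc_deriv_monom_def)
  then show monom: "bounded_clinear (nc_deriv_monom A T w)" for w
    by (simp only:)
      (intro bounded_clinear_sum_fun bounded_clinear_comp bounded_clinear_nc_monom A T)
  show "bounded_clinear (nc_deriv A T p)"
    unfolding nc_deriv_def[abs_def]
    by (intro bounded_clinear_sum_fun bounded_clinear_scaleC_fun monom)
qed

lemma cinner_nc_monom_rev:
  assumes A: "\<And>j. bounded_clinear (A j)" "\<And>j. cadj (A j) = A j"
  shows "cinner x (nc_monom A w y) = cinner (nc_monom A (rev w) x) y"
  by (induction w arbitrary: x) (simp_all add: cinner_cadj' A nc_monom_append)

text \<open>The Leibniz rule moves a monomial \<open>w\<close> across the derivation, so every \<open>nc_monom A w \<Omega>\<close>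
  lies in the domain of the adjoint of \<open>p \<Omega> \<mapsto> (\<partial> p) \<Omega>\<close>.\<close>

lemma nc_deriv_adjoint:
  assumes A: "\<And>j. bounded_clinear (A j)" "\<And>j. cadj (A j) = A j"
    and T: "\<And>j. bounded_clinear (T j)"
    and \<xi>: "\<And>p. cinner \<xi> (nc_eval A p \<Omega>) = cinner \<Omega> (nc_deriv A T p \<Omega>)"
  shows "\<exists>s. \<forall>p. cinner (nc_deriv A T p \<Omega>) (nc_monom A w \<Omega>) = cinner (nc_eval A p \<Omega>) s"
proof -
  let ?D = "nc_deriv_monom A T"
  \<comment> \<open>Solving the Leibniz rule for \<open>rev w @ v\<close> for the term that
    differentiates \<open>v\<close>: the whole derivative is represented by \<open>\<xi>\<close>,
    and the bounded derivative of \<open>rev w\<close> is moved to the other side by its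
    adjoint.\<close>
  define s where "s = nc_monom A w \<xi> - cadj (?D (rev w)) \<Omega>"
  have D: "bounded_clinear (?D u)" for u
    by (rule bounded_clinear_nc_deriv[OF A(1) T])
  have \<xi>_monom: "cinner (nc_monom A u \<Omega>) \<xi> = cinner (?D u \<Omega>) \<Omega>" for u
    using \<xi>[of "Poly_Mapping.single u 1"]
    by (metis cinner_commute nc_eval_word_sum nc_deriv_word_sum word_sum_single complex_vector.scale_one)
  have "cinner (?D v \<Omega>) (nc_monom A w \<Omega>) = cinner (nc_monom A v \<Omega>) s" for v
  proof -
    have "cinner (?D v \<Omega>) (nc_monom A w \<Omega>) =
        cinner (?D (rev w @ v) \<Omega>) \<Omega> - cinner (?D (rev w) (nc_monom A v \<Omega>)) \<Omega>"
      by (simp add: cinner_nc_monom_rev[OF A] nc_deriv_monom_append[OF A(1)] cinner_add_left)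
    also have "cinner (?D (rev w @ v) \<Omega>) \<Omega> = cinner (nc_monom A v \<Omega>) (nc_monom A w \<xi>)"
      by (simp add: \<xi>_monom[symmetric] nc_monom_append cinner_nc_monom_rev[OF A])
    finally show ?thesis
      by (simp add: s_def cinner_diff_right cinner_cadj[OF D])
  qed
  then have "cinner (nc_deriv A T p \<Omega>) (nc_monom A w \<Omega>) = cinner (nc_eval A p \<Omega>) s" for p
    by (simp add: nc_deriv_word_sum nc_eval_word_sum cinner_word_sum_left)
  then show ?thesis by blast
qed

section \<open>Closability and the equivalence with the commutator equations\<close>

text \<open>The adjoint is defined on the dense range of \<open>e\<close>. Each identity is a closed
  condition on pairs, so it survives in the closure of the graph and determines the second component
  from the first.\<close>

lemma closable_operatorI:
  assumes "closure (range e) = UNIV"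
    and "\<And>w. \<exists>s. \<forall>x\<in>D. cinner (Y x) (e w) = cinner x s"
  shows "closable_operator D Y"
  unfolding closable_operator_def
proof (rule single_valuedI)
  fix x y y'
  assume y: "(x, y) \<in> closure ((\<lambda>x. (x, Y x)) ` D)" and y': "(x, y') \<in> closure ((\<lambda>x. (x, Y x)) ` D)"
  have "y - y' = 0"
  proof (rule orthogonal_dense_eq_0[OF assms(1)])
    fix v assume "v \<in> range e"
    then obtain s where s: "\<And>x. x \<in> D \<Longrightarrow> cinner (Y x) v = cinner x s"
      using assms(2) by blast
    have "closed {q. cinner (snd q) v = cinner (fst q) s}"
      by (intro closed_Collect_eq bounded_linear.continuous_on[OF bounded_linear_cinner_left]
          continuous_intros)
    then have "closure ((\<lambda>x. (x, Y x)) ` D) \<subseteq> {q. cinner (snd q) v = cinner (fst q) s}"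
      using s by (intro closure_minimal) auto
    then have "cinner y v = cinner x s" "cinner y' v = cinner x s"
      using y y' by auto
    then show "cinner (y - y') v = 0"
      by (simp add: cinner_diff_left)
  qed
  then show "y = y'" by simp
qed

text \<open>The equivalence after the rank-one reduction. In one direction the operator is the
  derivation itself on polynomial vectors; in the other, \<open>\<xi>\<close> is the adjoint applied
  to \<open>\<Omega>\<close>.\<close>

lemma deriv_adjoint_iff_closable_commutator:
  fixes A T :: "'n \<Rightarrow> 'h \<Rightarrow> 'h::chilbert_space" and \<Omega> :: 'h
  assumes A: "\<And>j. bounded_clinear (A j)" "\<And>j. cadj (A j) = A j"
    and T: "\<And>j. bounded_clinear (T j)"
    and cyclic: "closure (nc_vectors A \<Omega>) = UNIV"
  shows "(\<exists>\<xi>. \<forall>p. cinner \<xi> (nc_eval A p \<Omega>) = cinner \<Omega> (nc_deriv A T p \<Omega>)) \<longleftrightarrow>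
     (\<exists>D Y. unbounded_operator D Y \<and> closable_operator D Y \<and> nc_vectors A \<Omega> \<subseteq> D \<and>
        Y \<Omega> = 0 \<and> \<Omega> \<in> adjoint_domain D Y \<and>
        (\<forall>j. \<forall>\<zeta>\<in>nc_vectors A \<Omega>. Y (A j \<zeta>) - A j (Y \<zeta>) = T j \<zeta>))"
    (is "?a \<longleftrightarrow> ?b")
proof
  assume ?a
  then obtain \<xi> where \<xi>: "\<And>p. cinner \<xi> (nc_eval A p \<Omega>) = cinner \<Omega> (nc_deriv A T p \<Omega>)"
    by blast
  obtain s where s: "\<And>w p. cinner (nc_deriv A T p \<Omega>) (nc_monom A w \<Omega>) = cinner (nc_eval A p \<Omega>) (s w)"
    using nc_deriv_adjoint[OF A T \<xi>] by metis
  \<comment> \<open>Different formal polynomials may evaluate to the same vector, so a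
    representative is chosen; the fact \<open>Y\<close> below shows that the choice is
    immaterial.\<close>
  define Y where "Y x = nc_deriv A T (SOME p. nc_eval A p \<Omega> = x) \<Omega>" for x
  define t where "t q = (\<Sum>w\<in>Poly_Mapping.keys q. Poly_Mapping.lookup q w *\<^sub>C s w)" for q
  have adj: "cinner (nc_deriv A T p \<Omega>) (nc_eval A q \<Omega>) = cinner (nc_eval A p \<Omega>) (t q)" for p q
    by (simp add: nc_eval_word_sum[of _ q] cinner_word_sum_right s t_def cinner_sum_right
        cinner_scaleC_right)
  have Y: "Y (nc_eval A p \<Omega>) = nc_deriv A T p \<Omega>" for p
  proof -
    define q where "q = (SOME q. nc_eval A q \<Omega> = nc_eval A p \<Omega>)"
    have q: "nc_eval A q \<Omega> = nc_eval A p \<Omega>"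
      unfolding q_def by (rule someI) (rule refl)
    \<comment> \<open>By \<open>adj\<close>, inner products of a derivative with polynomial vectors
      depend only on the evaluated vector; density does the rest.\<close>
    have "nc_deriv A T q \<Omega> - nc_deriv A T p \<Omega> = 0"
    proof (rule orthogonal_dense_eq_0[OF cyclic])
      fix v assume "v \<in> nc_vectors A \<Omega>"
      then show "cinner (nc_deriv A T q \<Omega> - nc_deriv A T p \<Omega>) v = 0"
        by (auto simp: nc_vectors_def cinner_diff_left adj q)
    qed
    then show ?thesis
      by (simp add: Y_def q_def)
  qed
  have in_vectors: "\<exists>p. x = nc_eval A p \<Omega>" if "x \<in> nc_vectors A \<Omega>" for x
    using that by (auto simp: nc_vectors_def)
  show ?b
  proof (intro exI conjI allI ballI)
    show "unbounded_operator (nc_vectors A \<Omega>) Y"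
      unfolding unbounded_operator_def
    proof (intro conjI ballI allI)
      show "complex_vector.subspace (nc_vectors A \<Omega>)"
        unfolding nc_vectors_word_sum by (rule subspace_range_word_sum)
      fix x c assume "x \<in> nc_vectors A \<Omega>"
      then obtain p where p: "x = nc_eval A p \<Omega>"
        using in_vectors by blast
      have "c *\<^sub>C x = nc_eval A (map_words (\<lambda>w. w) c p) \<Omega>"
        by (simp add: p nc_eval_word_sum word_sum_map_words)
      then show "Y (c *\<^sub>C x) = c *\<^sub>C Y x"
        by (simp add: p Y nc_deriv_word_sum word_sum_map_words)
      fix y assume "y \<in> nc_vectors A \<Omega>"
      then obtain q where q: "y = nc_eval A q \<Omega>"
        using in_vectors by blast
      have "x + y = nc_eval A (p + q) \<Omega>"
        by (simp add: p q nc_eval_word_sum word_sum_add)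
      then show "Y (x + y) = Y x + Y y"
        by (simp add: p q Y nc_deriv_word_sum word_sum_add)
    qed
    show "closable_operator (nc_vectors A \<Omega>) Y"
    proof (rule closable_operatorI[of "\<lambda>p. nc_eval A p \<Omega>"])
      show "closure (range (\<lambda>p. nc_eval A p \<Omega>)) = UNIV"
        using cyclic by (simp add: nc_vectors_def)
      show "\<exists>s. \<forall>x\<in>nc_vectors A \<Omega>. cinner (Y x) (nc_eval A q \<Omega>) = cinner x s" for q
        by (intro exI[of _ "t q"]) (auto simp: nc_vectors_def Y adj)
    qed
    show "\<Omega> \<in> adjoint_domain (nc_vectors A \<Omega>) Y"
      \<comment> \<open>The empty word evaluates to \<open>\<Omega>\<close>, so \<open>s []\<close>
        is the required witness.\<close>
      unfolding adjoint_domain_def using s[of _ "[]"] by (auto simp: nc_vectors_def Y)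
    show "Y \<Omega> = 0"
      using Y[of "Poly_Mapping.single [] 1"]
      by (simp add: nc_eval_word_sum nc_deriv_word_sum word_sum_single)
    fix j \<zeta> assume "\<zeta> \<in> nc_vectors A \<Omega>"
    then obtain p where p: "\<zeta> = nc_eval A p \<Omega>"
      using in_vectors by blast
    \<comment> \<open>The formal product of the variable \<open>j\<close> with \<open>p\<close>;
      differentiating it produces the commutator term \<open>T j\<close>.\<close>
    let ?q = "map_words (Cons j) 1 p"
    have "A j \<zeta> = nc_eval A ?q \<Omega>"
      by (simp add: p nc_eval_word_sum word_sum_map_words word_sum_bounded_clinear[OF A(1)])
    moreover have "nc_deriv A T ?q \<Omega> = T j \<zeta> + A j (nc_deriv A T p \<Omega>)"
      by (simp add: p nc_deriv_word_sum nc_eval_word_sum word_sum_map_words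
          nc_deriv_monom_Cons[OF A(1)] word_sum_distrib word_sum_bounded_clinear[OF A(1)]
          word_sum_bounded_clinear[OF T])
    ultimately show "Y (A j \<zeta>) - A j (Y \<zeta>) = T j \<zeta>"
      by (simp add: Y) (simp add: p Y)
  qed simp
next
  assume ?b
  then obtain D Y where lin: "unbounded_operator D Y" and sub: "nc_vectors A \<Omega> \<subseteq> D"
    and Y0: "Y \<Omega> = 0" and "\<Omega> \<in> adjoint_domain D Y"
    and comm: "\<And>j \<zeta>. \<zeta> \<in> nc_vectors A \<Omega> \<Longrightarrow> Y (A j \<zeta>) - A j (Y \<zeta>) = T j \<zeta>"
    by blast
  then obtain \<xi> where \<xi>: "\<And>x. x \<in> D \<Longrightarrow> cinner (Y x) \<Omega> = cinner x \<xi>"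
    by (auto simp: adjoint_domain_def)
  have D: "complex_vector.subspace D"
    using lin by (simp add: unbounded_operator_def)
  \<comment> \<open>The commutator equation gives \<open>Y\<close> the recursion of
    \<open>nc_deriv_monom_Cons\<close>, and \<open>Y \<Omega> = 0\<close> is its initial
    value.\<close>
  have Y_monom: "Y (nc_monom A w \<Omega>) = nc_deriv_monom A T w \<Omega>" for w
  proof (induction w)
    case (Cons j w)
    then show ?case
      using comm[OF nc_monom_in_nc_vectors, of j w]
      by (simp add: nc_deriv_monom_Cons[OF A(1)] diff_eq_eq)
  qed (simp add: Y0)
  have mem: "nc_monom A w \<Omega> \<in> D" for w
    using sub nc_monom_in_nc_vectors by blast
  have "cinner (nc_monom A w \<Omega>) \<xi> = cinner (nc_deriv_monom A T w \<Omega>) \<Omega>" for w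
    using \<xi>[OF mem] by (simp add: Y_monom)
  then have "cinner (nc_eval A p \<Omega>) \<xi> = cinner (nc_deriv A T p \<Omega>) \<Omega>" for p
    by (simp add: nc_eval_word_sum nc_deriv_word_sum cinner_word_sum_left)
  then show ?a
    by (intro exI[of _ \<xi>]) (metis cinner_commute)
qed

theorem theorem1:
  fixes M :: "('k::chilbert_space \<Rightarrow> 'k) set"
    and \<tau> :: "('k \<Rightarrow> 'k) \<Rightarrow> complex"
    and \<pi> :: "('k \<Rightarrow> 'k) \<Rightarrow> ('h::chilbert_space \<Rightarrow> 'h)"
    and \<Omega> :: 'h
    and X :: "'n::finite \<Rightarrow> 'k \<Rightarrow> 'k"
    and T :: "'n \<Rightarrow> 'h \<Rightarrow> 'h"
  assumes "tracial_von_neumann_algebra M \<tau>"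
    and "gns_triple M \<tau> \<pi> \<Omega>"
    and "\<And>j. X j \<in> M"
    and "\<And>j. cadj (X j) = X j"
    and "M = vn_generated (range X)"
    and "\<And>j. hilbert_schmidt (T j)"
  shows "(\<exists>\<xi>. \<forall>p :: 'n ncpoly.
            cinner \<xi> (nc_eval (\<lambda>j. \<pi> (X j)) p \<Omega>) =
            hs_inner (orth_proj (complex_vector.span {\<Omega>})) (nc_deriv (\<lambda>j. \<pi> (X j)) T p))
     \<longleftrightarrow>
     (\<exists>D Y. unbounded_operator D Y \<and> closable_operator D Y \<and>
        nc_vectors (\<lambda>j. \<pi> (X j)) \<Omega> \<subseteq> D \<and>
        Y \<Omega> = 0 \<and>
        \<Omega> \<in> adjoint_domain D Y \<and>
        (\<forall>j. \<forall>\<zeta>\<in>nc_vectors (\<lambda>j. \<pi> (X j)) \<Omega>.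
           Y (\<pi> (X j) \<zeta>) - \<pi> (X j) (Y \<zeta>) = T j \<zeta>))"
proof -
  interpret tracial_von_neumann_algebra M \<tau> by fact
  interpret gns_triple M \<tau> \<pi> \<Omega> by fact
  \<comment> \<open>The identity lies in every commutant, so it lies in \<open>M\<close>; its trace
    then makes \<open>\<Omega>\<close> a unit vector.\<close>
  have "id \<in> commutant (commutant M)"
    by (rule commutant_id)
  then have "id \<in> M"
    using von_neumann by (simp add: von_neumann_algebra_def)
  then have unit: "cinner \<Omega> \<Omega> = 1"
    using vector_state[of id] by (simp add: rep_unit trace_unit)
  have A: "bounded_clinear (\<pi> (X j))" "cadj (\<pi> (X j)) = \<pi> (X j)" for j
    using assms(3,4) rep_bounded rep_adj[of "X j"] by auto
  have T: "bounded_clinear (T j)" for j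
    using assms(6) by (simp add: hilbert_schmidt_def)
  \<comment> \<open>A basis comes from the Hilbert-Schmidt property of any one \<open>T j\<close>;
    an index exists since types are inhabited.\<close>
  obtain B :: "'h set" where B: "orthonormal_basis B"
    using assms(6) by (auto simp: hilbert_schmidt_def)
  have "hs_inner (orth_proj (complex_vector.span {\<Omega>})) (nc_deriv (\<lambda>j. \<pi> (X j)) T p) =
      cinner \<Omega> (nc_deriv (\<lambda>j. \<pi> (X j)) T p \<Omega>)" for p
    by (rule hs_inner_rank_one[OF unit bounded_clinear_nc_deriv(2)[OF A(1) T] B])
  then show ?thesis
    using deriv_adjoint_iff_closable_commutator[where A = "\<lambda>j. \<pi> (X j)", OF A T
        closure_nc_vectors[OF assms(1-5)]]
    by simp
qed

end
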